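(* Let $X$ be a Zariski space. Then any weakly closed and strongly bounded subset of $\mathcal{M}(X)$ is both compact and sequentially compact in the weak topology.
   Context: A topological space $X$ is Noetherian if every descending chain of closed subsets is eventually constant. A closed set $E\subseteq X$ is irreducible if it is not a union of two proper closed subsets. A Noetherian space $X$ is a Zariski space if every nonempty irreducible closed subset $E\subseteq X$ has a unique generic point, i.e. a unique point $x\in E$ with $\overline{\{x\}}=E$. $\mathcal{M}(X)$ is the real vector space of finite signed Borel measures on $X$. $SC(X)$ is the real vector space of functions $f=g-h$ with $g,h\colon X\to\mathbb{R}$ bounded upper semicontinuous (i.e. $\{g\ge r\}$ closed for all $r\in\mathbb{R}$), normed by $\|f\|=\sup_X|f|$; $SC(X)^*$ is its continuous dual. For Zariski $X$ the integration map $\Lambda\colon\mathcal{M}(X)\to SC(X)^*$, $\Lambda(\mu)(f)=\int_X f\,d\mu$, is a linear isomorphism. The strong and weak topologies on $\mathcal{M}(X)$ are the pull-backs via $\Lambda$ of the (dual) norm topology and the weak-$*$ topology of $SC(X)^*$, respectively; strongly bounded means bounded for the dual norm $\|\Lambda(\mu)\|$. *)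

theory Defs
  imports "HOL-Analysis.Analysis"
begin

definition noetherian_space :: "'a topology \<Rightarrow> bool" where
  "noetherian_space X \<longleftrightarrow>
     (\<forall>C :: nat \<Rightarrow> 'a set. (\<forall>n. closedin X (C n)) \<and> decseq C \<longrightarrow> (\<exists>N. \<forall>n\<ge>N. C n = C N))"

(* The empty set counts as irreducible; zariski_space excludes it explicitly. *)
definition irreducible_closedin :: "'a topology \<Rightarrow> 'a set \<Rightarrow> bool" where
  "irreducible_closedin X E \<longleftrightarrow> closedin X E \<and>
     \<not> (\<exists>A B. closedin X A \<and> closedin X B \<and> A \<subset> E \<and> B \<subset> E \<and> E = A \<union> B)"

definition zariski_space :: "'a topology \<Rightarrow> bool" where
  "zariski_space X \<longleftrightarrow> noetherian_space X \<and>
     (\<forall>E. irreducible_closedin X E \<and> E \<noteq> {} \<longrightarrow> (\<exists>!x. x \<in> E \<and> X closure_of {x} = E))"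


section \<open>Bounded upper semicontinuous functions and their differences\<close>

definition upper_semicontinuous :: "('a::topological_space \<Rightarrow> real) \<Rightarrow> bool" where
  "upper_semicontinuous f \<longleftrightarrow> (\<forall>r. closed {x. f x \<ge> r})"

definition bounded_usc :: "('a::topological_space \<Rightarrow> real) \<Rightarrow> bool" where
  "bounded_usc f \<longleftrightarrow> bounded (range f) \<and> upper_semicontinuous f"

lemma bounded_usc_const: "bounded_usc (\<lambda>_. c)"
  by (auto simp: bounded_usc_def upper_semicontinuous_def image_def)

lemma bounded_usc_add:
  assumes "bounded_usc f" "bounded_usc g"
  shows "bounded_usc (\<lambda>x. f x + g x)"
proof -
  have "open {x. f x < q}" "open {x. g x < q}" for q
    using assms by (auto simp: bounded_usc_def upper_semicontinuous_def closed_def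
        Collect_neg_eq[symmetric] not_le)
  then have "open (\<Union>q. {x. f x < q} \<inter> {x. g x < r - q})" for r
    by auto
  moreover have "(\<Union>q. {x. f x < q} \<inter> {x. g x < r - q}) = - {x. f x + g x \<ge> r}" for r
  proof (intro set_eqI iffI)
    fix x assume "x \<in> - {x. f x + g x \<ge> r}"
    then have "f x < r - g x" by auto
    then obtain q where "f x < q" "q < r - g x"
      using dense by blast
    then show "x \<in> (\<Union>q. {x. f x < q} \<inter> {x. g x < r - q})"
      by (auto intro!: exI[of _ q])
  qed auto
  ultimately show ?thesis
    using assms
    by (auto simp: bounded_usc_def upper_semicontinuous_def closed_def intro: bounded_plus_comp)
qed

lemma bounded_usc_scale:
  assumes "bounded_usc f" "c \<ge> 0"
  shows "bounded_usc (\<lambda>x. c * f x)"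
proof (cases "c = 0")
  case True
  then show ?thesis by (simp add: bounded_usc_const)
next
  case False
  then have "{x. c * f x \<ge> r} = {x. f x \<ge> r / c}" for r
    using assms(2) by (auto simp: field_simps)
  then show ?thesis
    using assms bounded_scaleR_comp[of f UNIV c]
    by (auto simp: bounded_usc_def upper_semicontinuous_def)
qed

typedef (overloaded) 'a sc =
  "{f :: 'a::topological_space \<Rightarrow> real.
     \<exists>g h. bounded_usc g \<and> bounded_usc h \<and> f = (\<lambda>x. g x - h x)}"
  morphisms apply_sc Abs_sc
  using bounded_usc_const by blast

setup_lifting type_definition_sc

instantiation sc :: (topological_space) real_vector
begin

lift_definition zero_sc :: "'a sc" is "\<lambda>_. 0"
  by (intro exI[of _ "\<lambda>_. 0"]) (simp add: bounded_usc_const)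

lift_definition plus_sc :: "'a sc \<Rightarrow> 'a sc \<Rightarrow> 'a sc" is "\<lambda>f g x. f x + g x"
proof (elim exE conjE)
  fix f f' g h g' h' :: "'a \<Rightarrow> real"
  assume "bounded_usc g" "bounded_usc h" "f = (\<lambda>x. g x - h x)"
    "bounded_usc g'" "bounded_usc h'" "f' = (\<lambda>x. g' x - h' x)"
  then show "\<exists>g h. bounded_usc g \<and> bounded_usc h \<and> (\<lambda>x. f x + f' x) = (\<lambda>x. g x - h x)"
    by (intro exI[of _ "\<lambda>x. g x + g' x"] exI[of _ "\<lambda>x. h x + h' x"]) (auto intro: bounded_usc_add)
qed

lift_definition scaleR_sc :: "real \<Rightarrow> 'a sc \<Rightarrow> 'a sc" is "\<lambda>c f x. c * f x"
proof (elim exE conjE)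
  fix c :: real and f g h :: "'a \<Rightarrow> real"
  assume *: "bounded_usc g" "bounded_usc h" "f = (\<lambda>x. g x - h x)"
  show "\<exists>g h. bounded_usc g \<and> bounded_usc h \<and> (\<lambda>x. c * f x) = (\<lambda>x. g x - h x)"
  proof (cases "c \<ge> 0")
    case True
    with * show ?thesis
      by (intro exI[of _ "\<lambda>x. c * g x"] exI[of _ "\<lambda>x. c * h x"])
         (auto intro: bounded_usc_scale simp: algebra_simps)
  next
    case False
    with * bounded_usc_scale[of h "- c"] bounded_usc_scale[of g "- c"] show ?thesis
      by (intro exI[of _ "\<lambda>x. - c * h x"] exI[of _ "\<lambda>x. - c * g x"])
         (auto simp: algebra_simps)
  qed
qed

definition uminus_sc :: "'a sc \<Rightarrow> 'a sc" where
  "uminus_sc f = (- 1) *\<^sub>R f"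

definition minus_sc :: "'a sc \<Rightarrow> 'a sc \<Rightarrow> 'a sc" where
  "minus_sc f g = f + - g"

lemma apply_sc_simps [simp]:
  "apply_sc 0 x = 0"
  "apply_sc (f + g) x = apply_sc f x + apply_sc g x"
  "apply_sc (c *\<^sub>R f) x = c * apply_sc f x"
  "apply_sc (- f) x = - apply_sc f x"
  "apply_sc (f - g) x = apply_sc f x - apply_sc g x"
  by (simp_all add: zero_sc.rep_eq plus_sc.rep_eq scaleR_sc.rep_eq uminus_sc_def minus_sc_def)

lemma sc_eqI: "(\<And>x. apply_sc f x = apply_sc g x) \<Longrightarrow> f = g"
  by (simp add: apply_sc_inject[symmetric] fun_eq_iff)

instance
  by standard (rule sc_eqI; simp add: algebra_simps)+

end

lemma apply_scE:
  obtains g h where "bounded_usc g" "bounded_usc h" "apply_sc f = (\<lambda>x. g x - h x)"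
  using apply_sc[of f] by blast

lemma bounded_range_apply_sc: "bounded (range (apply_sc f))"
  by (rule apply_scE[of f]) (auto simp: bounded_usc_def intro: bounded_minus_comp)

lemma bdd_above_abs_apply_sc: "bdd_above (range (\<lambda>x. \<bar>apply_sc f x\<bar>))"
  using bounded_range_apply_sc[of f] bounded_norm_comp[of "apply_sc f" UNIV]
  by (auto intro: bounded_imp_bdd_above)

instantiation sc :: (topological_space) real_normed_vector
begin

definition norm_sc :: "'a sc \<Rightarrow> real" where
  "norm_sc f = (SUP x. \<bar>apply_sc f x\<bar>)"

definition dist_sc :: "'a sc \<Rightarrow> 'a sc \<Rightarrow> real" where
  "dist_sc f g = norm (f - g)"

definition sgn_sc :: "'a sc \<Rightarrow> 'a sc" where
  "sgn_sc f = f /\<^sub>R norm f"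

definition uniformity_sc :: "('a sc \<times> 'a sc) filter" where
  "uniformity_sc = (INF e\<in>{0 <..}. principal {(f, g). dist f g < e})"

definition open_sc :: "'a sc set \<Rightarrow> bool" where
  "open_sc S = (\<forall>f\<in>S. \<forall>\<^sub>F (f', g) in uniformity. f' = f \<longrightarrow> g \<in> S)"

instance
proof
  fix f g :: "'a sc" and c :: real
  have le: "\<bar>apply_sc f x\<bar> \<le> norm f" for f :: "'a sc" and x
    unfolding norm_sc_def by (rule cSUP_upper[OF UNIV_I bdd_above_abs_apply_sc])
  have least: "norm f \<le> b" if "\<And>x. \<bar>apply_sc f x\<bar> \<le> b" for f :: "'a sc" and b
    unfolding norm_sc_def using that by (intro cSUP_least) auto
  show "norm f = 0 \<longleftrightarrow> f = 0"
  proof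
    assume "norm f = 0"
    then have "apply_sc f x = apply_sc 0 x" for x
      using le[of f x] by simp
    then show "f = 0"
      by (rule sc_eqI)
  qed (simp add: norm_sc_def)
  show "norm (f + g) \<le> norm f + norm g"
  proof (rule least)
    fix x show "\<bar>apply_sc (f + g) x\<bar> \<le> norm f + norm g"
      using le[of f x] le[of g x] by auto
  qed
  have scale: "norm (c *\<^sub>R f) \<le> \<bar>c\<bar> * norm f" for c and f :: "'a sc"
    by (rule least) (auto simp: abs_mult intro: mult_left_mono le)
  show "norm (c *\<^sub>R f) = \<bar>c\<bar> * norm f"
  proof (cases "c = 0")
    case True
    then show ?thesis by (simp add: norm_sc_def)
  next
    case False
    with scale[of "1 / c" "c *\<^sub>R f"] have "\<bar>c\<bar> * norm f \<le> norm (c *\<^sub>R f)"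
      by (simp add: field_simps)
    with scale[of c f] show ?thesis by simp
  qed
qed (simp_all only: dist_sc_def sgn_sc_def uniformity_sc_def open_sc_def)

end

lemma abs_apply_sc_le_norm: "\<bar>apply_sc f x\<bar> \<le> norm f"
  unfolding norm_sc_def by (rule cSUP_upper[OF UNIV_I bdd_above_abs_apply_sc])

lemma bounded_usc_borel_measurable: "bounded_usc f \<Longrightarrow> f \<in> borel_measurable borel"
  by (auto simp: borel_measurable_iff_ge bounded_usc_def upper_semicontinuous_def
      intro: borel_closed)

lemma apply_sc_borel_measurable [measurable]: "apply_sc f \<in> borel_measurable borel"
  by (rule apply_scE[of f]) (auto intro: bounded_usc_borel_measurable borel_measurable_diff)


section \<open>Finite signed Borel measures\<close>

(* A finite signed Borel measure lives on the Borel sigma-algebra only; giving it the value 0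
   off that algebra makes its representation as a total function unique. *)
definition finite_signed_borel :: "('a::topological_space set \<Rightarrow> real) \<Rightarrow> bool" where
  "finite_signed_borel \<mu> \<longleftrightarrow>
     \<mu> {} = 0 \<and>
     (\<forall>A :: nat \<Rightarrow> 'a set. range A \<subseteq> sets borel \<and> disjoint_family A \<longrightarrow>
        (\<lambda>n. \<mu> (A n)) sums \<mu> (\<Union>n. A n)) \<and>
     (\<forall>A. A \<notin> sets borel \<longrightarrow> \<mu> A = 0)"

lemma finite_signed_borel_sums:
  "finite_signed_borel \<mu> \<Longrightarrow> (\<And>n. A n \<in> sets borel) \<Longrightarrow> disjoint_family A \<Longrightarrow>
    (\<lambda>n. \<mu> (A n)) sums \<mu> (\<Union>n. A n)"
  by (auto simp: finite_signed_borel_def)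

lemma finite_signed_borel_Un:
  assumes "finite_signed_borel \<mu>" "A \<in> sets borel" "B \<in> sets borel" "A \<inter> B = {}"
  shows "\<mu> (A \<union> B) = \<mu> A + \<mu> B"
proof -
  have "(\<lambda>n. \<mu> (binaryset A B n)) sums \<mu> (\<Union>n. binaryset A B n)"
    using assms
    by (intro finite_signed_borel_sums) (auto simp: binaryset_def disjoint_family_on_def)
  moreover have "(\<lambda>n. \<mu> (binaryset A B n)) sums (\<mu> A + \<mu> B)"
    using assms(1) by (intro binaryset_sums) (simp add: finite_signed_borel_def)
  ultimately show ?thesis
    using sums_unique2 by (fastforce simp: UN_binaryset_eq)
qed

lemma finite_signed_borel_uminus: "finite_signed_borel \<mu> \<Longrightarrow> finite_signed_borel (\<lambda>A. - \<mu> A)"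
  by (auto simp: finite_signed_borel_def intro: sums_minus)

lemma finite_signed_borel_bounded:
  assumes "finite_signed_borel \<mu>"
  obtains C where "\<And>A. A \<in> sets borel \<Longrightarrow> \<bar>\<mu> A\<bar> \<le> C"
proof (rule ccontr)
  assume "\<not> thesis"
  define bad where "bad A \<longleftrightarrow> A \<in> sets borel \<and>
    (\<forall>C. \<exists>B\<in>sets borel. B \<subseteq> A \<and> \<bar>\<mu> B\<bar> > C)" for A
  have "bad UNIV"
    using \<open>\<not> thesis\<close> that unfolding bad_def by (metis not_le sets.top subset_UNIV space_borel)
  have step: "\<exists>B. bad B \<and> B \<subseteq> A \<and> \<bar>\<mu> (A - B)\<bar> \<ge> 1" if "bad A" for A
  proof -
    obtain B where B: "B \<in> sets borel" "B \<subseteq> A" "\<bar>\<mu> B\<bar> > \<bar>\<mu> A\<bar> + 1"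
      using \<open>bad A\<close> unfolding bad_def by blast
    have A: "A \<in> sets borel" using \<open>bad A\<close> by (simp add: bad_def)
    have "\<mu> (B \<union> (A - B)) = \<mu> B + \<mu> (A - B)"
      using A B by (intro finite_signed_borel_Un assms) auto
    then have eq: "\<mu> A = \<mu> B + \<mu> (A - B)"
      using B(2) by (simp add: Un_absorb1)
    have "bad B \<or> bad (A - B)"
    proof (rule ccontr)
      assume "\<not> ?thesis"
      then obtain C D where C: "\<And>E. E \<in> sets borel \<Longrightarrow> E \<subseteq> B \<Longrightarrow> \<bar>\<mu> E\<bar> \<le> C"
        and D: "\<And>E. E \<in> sets borel \<Longrightarrow> E \<subseteq> A - B \<Longrightarrow> \<bar>\<mu> E\<bar> \<le> D"
        using A B unfolding bad_def by (meson not_le sets.Diff)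
      obtain E where E: "E \<in> sets borel" "E \<subseteq> A" "\<bar>\<mu> E\<bar> > C + D"
        using \<open>bad A\<close> unfolding bad_def by blast
      have "\<mu> ((E \<inter> B) \<union> (E - B)) = \<mu> (E \<inter> B) + \<mu> (E - B)"
        using E B by (intro finite_signed_borel_Un assms) auto
      then have "\<mu> E = \<mu> (E \<inter> B) + \<mu> (E - B)"
        by (simp add: Int_Diff_Un)
      moreover have "\<bar>\<mu> (E \<inter> B)\<bar> \<le> C" "\<bar>\<mu> (E - B)\<bar> \<le> D"
        using E B by (auto intro!: C D)
      ultimately show False
        using E(3) by linarith
    qed
    then show ?thesis
    proof
      assume "bad B"
      with B eq show ?thesis by (intro exI[of _ B]) auto
    next
      assume "bad (A - B)"
      moreover have "A - (A - B) = B" using B(2) by auto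
      ultimately show ?thesis using B by (intro exI[of _ "A - B"]) auto
    qed
  qed
  have "\<exists>F. \<forall>n. bad (F n) \<and> (F (Suc n) \<subseteq> F n \<and> \<bar>\<mu> (F n - F (Suc n))\<bar> \<ge> 1)"
    by (rule dependent_nat_choice) (use \<open>bad UNIV\<close> step in auto)
  then obtain F where F: "\<And>n. bad (F n)"
    and FS: "\<And>n. F (Suc n) \<subseteq> F n \<and> \<bar>\<mu> (F n - F (Suc n))\<bar> \<ge> 1"
    by auto
  have dec: "decseq F"
    using FS by (intro decseq_SucI) auto
  have "disjoint_family (\<lambda>n. F n - F (Suc n))"
    unfolding disjoint_family_on_def
  proof (intro ballI impI)
    fix m n :: nat assume "m \<noteq> n"
    then have "F n \<subseteq> F (Suc m) \<or> F m \<subseteq> F (Suc n)"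
      using decseqD[OF dec, of "Suc m" n] decseqD[OF dec, of "Suc n" m] by linarith
    then show "(F m - F (Suc m)) \<inter> (F n - F (Suc n)) = {}"
      by auto
  qed
  then have "(\<lambda>n. \<mu> (F n - F (Suc n))) sums \<mu> (\<Union>n. F n - F (Suc n))"
    using F by (intro finite_signed_borel_sums assms) (auto simp: bad_def)
  then have "(\<lambda>n. \<mu> (F n - F (Suc n))) \<longlonglongrightarrow> 0"
    by (intro summable_LIMSEQ_zero sums_summable)
  then have "(\<lambda>n. \<bar>\<mu> (F n - F (Suc n))\<bar>) \<longlonglongrightarrow> 0"
    by (rule tendsto_rabs_zero)
  then have "1 \<le> (0::real)"
    by (rule LIMSEQ_le_const) (use FS in auto)
  then show False by simp
qed

(* Jordan decomposition: the positive variation of A is the supremum of the values on Borel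
   subsets of A; ennreal truncates negative values to 0, and the empty subset has value 0. *)
definition pos_variation :: "('a::topological_space set \<Rightarrow> real) \<Rightarrow> 'a measure" where
  "pos_variation \<mu> =
     measure_of UNIV (sets borel) (\<lambda>A. SUP B\<in>{B \<in> sets borel. B \<subseteq> A}. ennreal (\<mu> B))"

definition neg_variation :: "('a::topological_space set \<Rightarrow> real) \<Rightarrow> 'a measure" where
  "neg_variation \<mu> = pos_variation (\<lambda>A. - \<mu> A)"

lemma sets_pos_variation [measurable_cong]: "sets (pos_variation \<mu>) = sets borel"
  unfolding pos_variation_def
  using sets.sets_measure_of_eq[of borel] by simp

lemma space_pos_variation [simp]: "space (pos_variation \<mu>) = UNIV"
  using sets_eq_imp_space_eq[OF sets_pos_variation] by simp

lemma emeasure_pos_variation: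
  assumes \<mu>: "finite_signed_borel \<mu>" and A: "A \<in> sets borel"
  shows "emeasure (pos_variation \<mu>) A = (SUP B\<in>{B \<in> sets borel. B \<subseteq> A}. ennreal (\<mu> B))"
proof (rule emeasure_measure_of[OF pos_variation_def])
  define p where "p A = (SUP B\<in>{B \<in> sets borel. B \<subseteq> A}. ennreal (\<mu> B))" for A
  have upper: "ennreal (\<mu> B) \<le> p A" if "B \<in> sets borel" "B \<subseteq> A" for A B
    unfolding p_def using that by (intro SUP_upper) auto
  have least: "p A \<le> u" if "\<And>B. B \<in> sets borel \<Longrightarrow> B \<subseteq> A \<Longrightarrow> ennreal (\<mu> B) \<le> u" for A u
    unfolding p_def using that by (intro SUP_least) auto
  have p_empty: "p {} = 0"
    using \<mu> by (intro antisym least) (auto simp: finite_signed_borel_def)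
  have p_mono: "p A \<le> p B" if "A \<subseteq> B" for A B
    using that by (intro least upper) auto
  have p_Un: "p A + p B \<le> p (A \<union> B)" if "A \<inter> B = {}" for A B
  proof -
    have *: "ennreal (\<mu> C) + ennreal (\<mu> D) \<le> p (A \<union> B)"
      if "C \<in> sets borel" "C \<subseteq> A" "D \<in> sets borel" "D \<subseteq> B" for C D
    proof -
      have "\<mu> (C \<union> D) = \<mu> C + \<mu> D"
        using that \<open>A \<inter> B = {}\<close> by (intro finite_signed_borel_Un \<mu>) auto
      moreover have "ennreal (\<mu> (C \<union> D)) \<le> p (A \<union> B)" "ennreal (\<mu> C) \<le> p (A \<union> B)"
        "ennreal (\<mu> D) \<le> p (A \<union> B)"
        using that by (auto intro!: upper)
      ultimately show ?thesis
        by (cases "\<mu> C \<ge> 0"; cases "\<mu> D \<ge> 0") (auto simp: ennreal_neg)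
    qed
    have ne: "{B \<in> sets borel. B \<subseteq> A} \<noteq> {}" for A :: "'a set"
      by (auto intro!: exI[of _ "{}"])
    have "p A + p B = (SUP C\<in>{C \<in> sets borel. C \<subseteq> A}. ennreal (\<mu> C) + p B)"
      unfolding p_def[of A] by (rule ennreal_SUP_add_left[OF ne, symmetric]) 
    also have "\<dots> \<le> p (A \<union> B)"
    proof (rule SUP_least)
      fix C assume C: "C \<in> {C \<in> sets borel. C \<subseteq> A}"
      have "ennreal (\<mu> C) + p B = (SUP D\<in>{D \<in> sets borel. D \<subseteq> B}. ennreal (\<mu> C) + ennreal (\<mu> D))"
        unfolding p_def by (rule ennreal_SUP_add_right[OF ne])
      also have "\<dots> \<le> p (A \<union> B)"
        using C by (intro SUP_least *) auto
      finally show "ennreal (\<mu> C) + p B \<le> p (A \<union> B)" .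
    qed
    finally show ?thesis .
  qed
  have "positive (sets borel) p"
    by (simp add: positive_def p_empty)
  moreover have "countably_additive (sets borel) p"
    unfolding countably_additive_def
  proof (intro allI impI)
    fix A :: "nat \<Rightarrow> 'a set"
    assume A: "range A \<subseteq> sets borel" "disjoint_family A"
    show "(\<Sum>n. p (A n)) = p (\<Union>n. A n)"
    proof (rule antisym)
      have "(\<Sum>i<n. p (A i)) \<le> p (\<Union>i<n. A i)" for n
      proof (induction n)
        case (Suc n)
        have "A i \<inter> A n = {}" if "i < n" for i
          using that by (intro disjoint_family_onD[OF A(2)]) auto
        then have "(\<Union>i<n. A i) \<inter> A n = {}"
          by blast
        then have "p (\<Union>i<n. A i) + p (A n) \<le> p ((\<Union>i<n. A i) \<union> A n)"
          by (rule p_Un)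
        moreover have "(\<Union>i<Suc n. A i) = (\<Union>i<n. A i) \<union> A n"
          by (auto simp: less_Suc_eq)
        ultimately show ?case
          using order_trans[OF add_right_mono[OF Suc, of "p (A n)"]] by simp
      qed (simp add: p_empty)
      also have "p (\<Union>i<n. A i) \<le> p (\<Union>n. A n)" for n
        by (rule p_mono) auto
      finally show "(\<Sum>n. p (A n)) \<le> p (\<Union>n. A n)"
        by (intro suminf_le_const) auto
    next
      show "p (\<Union>n. A n) \<le> (\<Sum>n. p (A n))"
      proof (rule least)
        fix B assume B: "B \<in> sets borel" "B \<subseteq> (\<Union>n. A n)"
        have "(\<lambda>n. \<mu> (B \<inter> A n)) sums \<mu> (\<Union>n. B \<inter> A n)"
          using A B by (intro finite_signed_borel_sums \<mu>) (auto simp: disjoint_family_on_def)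
        moreover have "(\<Union>n. B \<inter> A n) = B"
          using B(2) by auto
        ultimately have "(\<lambda>n. \<Sum>i<n. \<mu> (B \<inter> A i)) \<longlonglongrightarrow> \<mu> B"
          by (simp add: sums_def)
        then have "(\<lambda>n. ennreal (\<Sum>i<n. \<mu> (B \<inter> A i))) \<longlonglongrightarrow> ennreal (\<mu> B)"
          by (rule tendsto_ennrealI)
        moreover have "ennreal (\<Sum>i<n. \<mu> (B \<inter> A i)) \<le> (\<Sum>n. p (A n))" for n
        proof -
          have "ennreal (\<Sum>i<n. \<mu> (B \<inter> A i)) \<le> ennreal (\<Sum>i<n. max 0 (\<mu> (B \<inter> A i)))"
            by (intro ennreal_leI sum_mono) auto
          also have "\<dots> = (\<Sum>i<n. ennreal (max 0 (\<mu> (B \<inter> A i))))"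
            by (rule sum_ennreal[symmetric]) auto
          also have "\<dots> = (\<Sum>i<n. ennreal (\<mu> (B \<inter> A i)))"
            by (intro sum.cong refl) (simp add: max_def ennreal_neg)
          also have "\<dots> \<le> (\<Sum>i<n. p (A i))"
            using A B by (intro sum_mono upper) auto
          also have "\<dots> \<le> (\<Sum>n. p (A n))"
            by (intro sum_le_suminf) auto
          finally show ?thesis .
        qed
        ultimately show "ennreal (\<mu> B) \<le> (\<Sum>n. p (A n))"
          by (intro LIMSEQ_le_const2) auto
      qed
    qed
  qed
  ultimately show
    "positive (sets (pos_variation \<mu>)) (\<lambda>A. SUP B\<in>{B \<in> sets borel. B \<subseteq> A}. ennreal (\<mu> B))"
    "countably_additive (sets (pos_variation \<mu>))
       (\<lambda>A. SUP B\<in>{B \<in> sets borel. B \<subseteq> A}. ennreal (\<mu> B))"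
    by (simp_all add: sets_pos_variation p_def[abs_def])
qed (use A in \<open>auto simp: sets_pos_variation\<close>)

lemma finite_measure_pos_variation:
  assumes "finite_signed_borel \<mu>"
  shows "finite_measure (pos_variation \<mu>)"
proof (rule finite_measureI)
  obtain C where C: "\<And>A. A \<in> sets borel \<Longrightarrow> \<bar>\<mu> A\<bar> \<le> C"
    using finite_signed_borel_bounded[OF assms] by blast
  have "emeasure (pos_variation \<mu>) UNIV \<le> ennreal C"
    unfolding emeasure_pos_variation[OF assms borel_open[OF open_UNIV]]
    by (intro SUP_least ennreal_leI) (use C in \<open>force simp: abs_le_iff\<close>)
  then show "emeasure (pos_variation \<mu>) (space (pos_variation \<mu>)) \<noteq> \<infinity>"
    using order.strict_trans1[OF _ ennreal_less_top] by fastforce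
qed

lemma bounded_linear_integral_sc:
  assumes "finite_measure M" "sets M = sets borel"
  shows "bounded_linear (\<lambda>f. integral\<^sup>L M (apply_sc f))"
proof -
  interpret finite_measure M by fact
  have meas: "apply_sc f \<in> borel_measurable M" for f
    using apply_sc_borel_measurable measurable_cong_sets[OF assms(2) refl] by blast
  have int: "integrable M (apply_sc f)" for f
    by (rule integrable_const_bound[of _ "norm f"]) (simp_all add: abs_apply_sc_le_norm meas)
  show ?thesis
  proof (rule bounded_linear_intro)
    fix f g :: "'a sc" and c :: real
    show "integral\<^sup>L M (apply_sc (f + g)) = integral\<^sup>L M (apply_sc f) + integral\<^sup>L M (apply_sc g)"
      using Bochner_Integration.integral_add[OF int[of f] int[of g]]
      by (simp add: plus_sc.rep_eq)
    show "integral\<^sup>L M (apply_sc (c *\<^sub>R f)) = c *\<^sub>R integral\<^sup>L M (apply_sc f)"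
      by (simp add: scaleR_sc.rep_eq)
    have "norm (integral\<^sup>L M (apply_sc f)) \<le> (\<integral>x. norm (apply_sc f x) \<partial>M)"
      by (rule integral_norm_bound)
    also have "\<dots> \<le> (\<integral>x. norm f \<partial>M)"
      by (intro integral_mono integrable_norm int) (simp_all add: abs_apply_sc_le_norm)
    finally show "norm (integral\<^sup>L M (apply_sc f)) \<le> norm f * measure M (space M)"
      by (simp add: mult.commute)
  qed
qed

typedef (overloaded) 'a signed_measure =
  "{\<mu> :: 'a::topological_space set \<Rightarrow> real. finite_signed_borel \<mu>}"
  morphisms smeasure Abs_signed_measure
  by (rule exI[of _ "\<lambda>_. 0"]) (simp add: finite_signed_borel_def)

setup_lifting type_definition_signed_measure


section \<open>The integration map and the weak topology\<close>

lift_definition integration_map ::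
    "'a::topological_space signed_measure \<Rightarrow> ('a sc \<Rightarrow>\<^sub>L real)" is
  "\<lambda>\<mu> f. integral\<^sup>L (pos_variation \<mu>) (apply_sc f) - integral\<^sup>L (neg_variation \<mu>) (apply_sc f)"
  unfolding neg_variation_def
  by (intro bounded_linear_sub bounded_linear_integral_sc finite_measure_pos_variation
      finite_signed_borel_uminus sets_pos_variation) auto

(* euclidean on the function type is the topology of pointwise convergence. *)
definition weak_star_topology :: "('b::real_normed_vector \<Rightarrow>\<^sub>L real) topology" where
  "weak_star_topology =
     pullback_topology UNIV blinfun_apply (euclidean :: ('b \<Rightarrow> real) topology)"

definition weak_topology :: "'a::topological_space signed_measure topology" where
  "weak_topology = pullback_topology UNIV integration_map weak_star_topology"

(* Boundedness in the strong topology: the norm on the dual is the operator norm of blinfun. *)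
definition strongly_bounded :: "'a::topological_space signed_measure set \<Rightarrow> bool" where
  "strongly_bounded S \<longleftrightarrow> bounded (integration_map ` S)"

definition seq_compactin :: "'a topology \<Rightarrow> 'a set \<Rightarrow> bool" where
  "seq_compactin X S \<longleftrightarrow> S \<subseteq> topspace X \<and>
     (\<forall>s :: nat \<Rightarrow> 'a. range s \<subseteq> S \<longrightarrow>
        (\<exists>l\<in>S. \<exists>r :: nat \<Rightarrow> nat. strict_mono r \<and> limitin X (s \<circ> r) l sequentially))"

end

theory Submission
  imports Defs "HOL-Library.Diagonal_Subsequence"
begin

text \<open>Indicators of closed sets span a dense subspace of $SC(X)$, so a functional is determined by
its values on them. On a Zariski space every bounded functional is a summable family of point masses
at generic points (Noetherian recursion), hence integration against a measure; so the weak topology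
on a strongly bounded, weakly closed set is that of a weak-$*$ compact set (Banach--Alaoglu).
For sequential compactness the masses are split into positive and negative parts, and Noetherian
induction yields a subsequence converging on all closed sets. There may be uncountably many closed
sets even below a countable set of points, so plain diagonalisation is not enough: in an irreducible
$E$ one diagonalises over proper closed subsets that asymptotically exhaust the mass which any
further subsequence can place on proper closed subsets of $E$.\<close>

section \<open>Noetherian induction\<close>

lemma wf_closed_psubset:
  assumes "noetherian_space (euclidean :: 'a::topological_space topology)"
  shows "wf {(A, B :: 'a set). closed A \<and> closed B \<and> A \<subset> B}"
proof (rule ccontr)
  assume "\<not> ?thesis"
  then obtain C :: "nat \<Rightarrow> 'a set"
    where "\<And>n. (C (Suc n), C n) \<in> {(A, B). closed A \<and> closed B \<and> A \<subset> B}"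
    unfolding wf_iff_no_infinite_down_chain by metis
  then have C: "closed (C n)" "C (Suc n) \<subset> C n" for n
    by blast+
  then have "decseq C"
    by (intro decseq_SucI) auto
  then obtain N where "\<forall>n\<ge>N. C n = C N"
    using assms C(1) unfolding noetherian_space_def by force
  then show False
    using C(2)[of N] by (metis le_SucI order_refl psubset_eq)
qed

lemma irreducible_closedin_Un:
  assumes "irreducible_closedin euclidean E" "closed A" "closed B" "A \<subset> E" "B \<subset> E"
  shows "A \<union> B \<subset> E"
proof -
  have "E \<noteq> A \<union> B"
    using assms unfolding irreducible_closedin_def closed_closedin[symmetric] by blast
  then show ?thesis
    using assms(4,5) by auto
qed

lemma irreducible_closedin_Union:
  assumes E: "irreducible_closedin euclidean E" "E \<noteq> {}"
    and "finite \<A>" "\<And>A. A \<in> \<A> \<Longrightarrow> closed A \<and> A \<subset> E"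
  shows "\<Union>\<A> \<subset> E"
  using assms(3,4)
proof (induction \<A> rule: finite_induct)
  case empty
  then show ?case using E by auto
next
  case (insert A \<A>)
  then have "A \<union> \<Union>\<A> \<subset> E"
    by (intro irreducible_closedin_Un[OF E(1)] closed_Union) auto
  then show ?case by simp
qed

text \<open>Well-founded induction along proper inclusion of closed sets: a nonempty closed set that
  is not irreducible splits into two smaller ones. The \<open>Un\<close> case also supplies
  \<open>A \<inter> B\<close>, because modular quantities are computed on a union from the two parts
  and their intersection.\<close>

lemma noetherian_closed_induct [consumes 2, case_names empty irreducible Un]:
  fixes E :: "'a::topological_space set"
  assumes noeth: "noetherian_space (euclidean :: 'a topology)" and "closed E"
    and empty: "P {}"
    and irreducible: "\<And>E. irreducible_closedin euclidean E \<Longrightarrow> closed E \<Longrightarrow> E \<noteq> {} \<Longrightarrow>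
        (\<And>F. closed F \<Longrightarrow> F \<subset> E \<Longrightarrow> P F) \<Longrightarrow> P E"
    and Un: "\<And>A B. closed A \<Longrightarrow> closed B \<Longrightarrow> P A \<Longrightarrow> P B \<Longrightarrow> P (A \<inter> B) \<Longrightarrow> P (A \<union> B)"
  shows "P E"
  using wf_closed_psubset[OF noeth] \<open>closed E\<close>
proof (induction E rule: wf_induct_rule)
  case (less E)
  then have IH: "P F" if "closed F" "F \<subset> E" for F
    using that by auto
  show ?case
  proof (cases "E = {} \<or> irreducible_closedin euclidean E")
    case True
    then show ?thesis
      using empty irreducible less.prems IH by metis
  next
    case False
    then obtain A B where AB: "closed A" "closed B" "A \<subset> E" "B \<subset> E" "E = A \<union> B"
      using less.prems unfolding irreducible_closedin_def closed_closedin[symmetric] by blast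
    moreover have "P (A \<inter> B)"
      using AB by (intro IH closed_Int) auto
    ultimately show ?thesis
      using Un[OF AB(1,2)] IH by auto
  qed
qed

section \<open>Generic points and specialisation\<close>

lemma irreducible_closedin_closure_singleton:
  "irreducible_closedin euclidean (closure {x})"
  unfolding irreducible_closedin_def
proof (intro conjI notI)
  assume "\<exists>A B. closedin euclidean A \<and> closedin euclidean B \<and> A \<subset> closure {x} \<and>
    B \<subset> closure {x} \<and> closure {x} = A \<union> B"
  then obtain A B where AB: "closed A" "closed B" "A \<subset> closure {x}" "B \<subset> closure {x}"
      "closure {x} = A \<union> B"
    unfolding closed_closedin[symmetric] by blast
  then have "x \<in> A \<or> x \<in> B"
    using closure_subset[of "{x}"] by auto
  then have "closure {x} \<subseteq> A \<or> closure {x} \<subseteq> B"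
    using closure_minimal[of "{x}"] AB(1,2) by auto
  then show False
    using AB(3,4) by (metis less_le_not_le)
qed auto

text \<open>\<open>closure {x}\<close> is irreducible, and uniqueness of its generic point makes
  point closures injective (the T0 property).\<close>

lemma zariski_closure_singleton_eq_iff:
  assumes "zariski_space (euclidean :: 'a::topological_space topology)"
  shows "closure {x} = closure {y} \<longleftrightarrow> x = (y :: 'a)"
proof
  assume eq: "closure {x} = closure {y}"
  have "irreducible_closedin euclidean (closure {x})" "closure {x} \<noteq> {}"
    using irreducible_closedin_closure_singleton by auto
  then have "\<exists>!z. z \<in> closure {x} \<and> closure {z} = closure {x}"
    using assms unfolding zariski_space_def by (metis euclidean_closure_of)
  moreover have "x \<in> closure {x}" "y \<in> closure {x}"
    using closure_subset eq by fastforce+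
  ultimately show "x = y"
    using eq by blast
qed simp

text \<open>This strict descent drives both the choice of minimal closures in the interpolation and
  the recursion for the point masses.\<close>

lemma zariski_closure_singleton_psubset:
  assumes "zariski_space (euclidean :: 'a::topological_space topology)"
    and "y \<in> closure {x}" "y \<noteq> (x :: 'a)"
  shows "closure {y} \<subset> closure {x}"
proof -
  have "closure {y} \<subseteq> closure {x}"
    using assms(2) by (intro closure_minimal) auto
  then show ?thesis
    using zariski_closure_singleton_eq_iff[OF assms(1), of y x] assms(3) by simp
qed

section \<open>Indicator functions of closed sets\<close>

lemma bounded_usc_indicator: "closed E \<Longrightarrow> bounded_usc (indicator E :: 'a::topological_space \<Rightarrow> real)"
proof -
  assume "closed E"
  moreover have "{x. indicator E x \<ge> r} = (if r \<le> 0 then UNIV else if r \<le> 1 then E else {})" for r :: real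
    by (auto simp: indicator_def)
  ultimately show ?thesis
    by (auto simp: bounded_usc_def upper_semicontinuous_def intro!: boundedI[of _ 1]
        simp: indicator_def)
qed

definition sc_indicator :: "'a::topological_space set \<Rightarrow> 'a sc" where
  "sc_indicator E = Abs_sc (indicator E)"

lemma apply_sc_indicator [simp]:
  assumes "closed E"
  shows "apply_sc (sc_indicator E) = indicator E"
  unfolding sc_indicator_def
proof (intro Abs_sc_inverse CollectI exI conjI)
  show "bounded_usc (indicator E :: 'a \<Rightarrow> real)"
    using assms by (rule bounded_usc_indicator)
  show "bounded_usc (\<lambda>_ :: 'a. 0)"
    by (rule bounded_usc_const)
qed simp

lemma sc_indicator_Un:
  assumes "closed A" "closed B"
  shows "sc_indicator (A \<union> B) = sc_indicator A + sc_indicator B - sc_indicator (A \<inter> B)"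
  by (rule sc_eqI) (use assms in \<open>auto simp: closed_Un closed_Int indicator_def\<close>)

lemma sc_indicator_empty [simp]: "sc_indicator {} = 0"
  by (rule sc_eqI) auto

section \<open>Uniform approximation by step functions\<close>

lemma norm_sc_le:
  assumes "\<And>x. \<bar>apply_sc f x\<bar> \<le> b"
  shows "norm f \<le> b"
  unfolding norm_sc_def using assms by (intro cSUP_least) auto

text \<open>Restricting to closed subsets of \<open>E\<close> localises the step functions: during
  the Noetherian induction a functional is known only on closed sets inside some
  \<open>E\<close>.\<close>

abbreviation sc_step :: "'a::topological_space set \<Rightarrow> 'a sc set" where
  "sc_step E \<equiv> span (sc_indicator ` {F. closed F \<and> F \<subseteq> E})"

lemma apply_sc_sum: "apply_sc (sum f A) x = (\<Sum>i\<in>A. apply_sc (f i) x)"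
  by (induction A rule: infinite_finite_induct) auto

text \<open>Staircase approximation: above the base level \<open>- M\<close>, one step of height
  \<open>e\<close> is added for each superlevel set containing the point, and superlevel sets are
  closed by semicontinuity.\<close>

lemma bounded_usc_approx:
  assumes "bounded_usc g" "e > 0"
  obtains f where "f \<in> sc_step UNIV" "\<And>x. \<bar>g x - apply_sc f x\<bar> \<le> e"
proof -
  obtain M where M: "\<And>x. \<bar>g x\<bar> \<le> M"
    using assms(1) unfolding bounded_usc_def bounded_iff by auto
  \<comment> \<open>\<open>n\<close> steps of height \<open>e\<close> starting at \<open>- M\<close>
    reach at least \<open>M\<close>, so the staircase covers the range of \<open>g\<close>.\<close>
  define n where "n = nat \<lceil>2 * M / e\<rceil>"
  define F where "F k = {x. g x \<ge> - M + real k * e}" for k :: nat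
  have F: "closed (F k)" for k
    using assms(1) unfolding F_def bounded_usc_def upper_semicontinuous_def by blast
  \<comment> \<open>Level 0 is the whole space and is accounted for by the constant
    \<open>- M\<close>, so the sum starts at 1.\<close>
  define f where "f = (- M) *\<^sub>R sc_indicator UNIV + e *\<^sub>R (\<Sum>k\<in>{1..n}. sc_indicator (F k))"
  show thesis
  proof
    show "f \<in> sc_step UNIV"
      unfolding f_def by (intro span_add span_scale span_sum span_base) (auto simp: F)
    fix x
    define v where "v = g x + M"
    have v: "0 \<le> v" "v \<le> 2 * M"
      using M[of x] by (auto simp: v_def)
    have "v / e \<le> 2 * M / e"
      using v assms(2) by (simp add: divide_right_mono)
    then have n: "nat \<lfloor>v / e\<rfloor> \<le> n"
      unfolding n_def by (intro nat_mono) linarith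
    \<comment> \<open>The levels are nested, so the sum counts how many of them \<open>x\<close> has
      reached: \<open>g x\<close> is rounded down to the grid \<open>- M + e * k\<close>.\<close>
    have "(\<Sum>k\<in>{1..n}. indicator (F k) x :: real) = (\<Sum>k\<in>{1..nat \<lfloor>v / e\<rfloor>}. 1)"
    proof (rule sum.mono_neutral_cong_right)
      have *: "x \<in> F k \<longleftrightarrow> k \<le> nat \<lfloor>v / e\<rfloor>" for k
      proof -
        have "x \<in> F k \<longleftrightarrow> real k \<le> v / e"
          using assms(2) by (auto simp: F_def v_def field_simps)
        also have "\<dots> \<longleftrightarrow> k \<le> nat \<lfloor>v / e\<rfloor>"
          using v assms(2) by (simp add: le_nat_iff le_floor_iff)
        finally show ?thesis .
      qed
      show "\<forall>i\<in>{1..n} - {1..nat \<lfloor>v / e\<rfloor>}. indicator (F i) x = (0 :: real)"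
        using * by (auto simp: indicator_def)
      show "\<And>k. k \<in> {1..nat \<lfloor>v / e\<rfloor>} \<Longrightarrow> indicator (F k) x = (1 :: real)"
        using * by (auto simp: indicator_def)
    qed (use n in auto)
    also have "\<dots> = real_of_int \<lfloor>v / e\<rfloor>"
      using v assms(2) by simp
    finally have "apply_sc f x = - M + e * real_of_int \<lfloor>v / e\<rfloor>"
      by (simp add: f_def apply_sc_sum F)
    then have eq: "g x - apply_sc f x = v - e * real_of_int \<lfloor>v / e\<rfloor>"
      by (simp add: v_def)
    have "e * real_of_int \<lfloor>v / e\<rfloor> \<le> e * (v / e)" "e * (v / e) \<le> e * (real_of_int \<lfloor>v / e\<rfloor> + 1)"
      using assms(2) by (intro mult_left_mono; linarith)+
    then have "e * real_of_int \<lfloor>v / e\<rfloor> \<le> v" "v \<le> e * real_of_int \<lfloor>v / e\<rfloor> + e"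
      using assms(2) by (simp_all add: algebra_simps)
    then show "\<bar>g x - apply_sc f x\<bar> \<le> e"
      unfolding eq by auto
  qed
qed

lemma sc_step_dense:
  fixes f :: "'a::topological_space sc"
  assumes "e > 0"
  obtains g where "g \<in> sc_step UNIV" "norm (f - g) \<le> e"
proof -
  obtain u v where uv: "bounded_usc u" "bounded_usc v" "apply_sc f = (\<lambda>x. u x - v x)"
    by (rule apply_scE)
  obtain u' where u': "u' \<in> sc_step UNIV" "\<And>x. \<bar>u x - apply_sc u' x\<bar> \<le> e / 2"
    using bounded_usc_approx[OF uv(1), of "e / 2"] assms by auto
  obtain v' where v': "v' \<in> sc_step UNIV" "\<And>x. \<bar>v x - apply_sc v' x\<bar> \<le> e / 2"
    using bounded_usc_approx[OF uv(2), of "e / 2"] assms by auto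
  show thesis
  proof
    show "u' - v' \<in> sc_step UNIV"
      using u' v' by (intro span_diff)
    show "norm (f - (u' - v')) \<le> e"
    proof (rule norm_sc_le)
      fix x show "\<bar>apply_sc (f - (u' - v')) x\<bar> \<le> e"
        using u'(2)[of x] v'(2)[of x] unfolding apply_sc_simps uv(3) by linarith
    qed
  qed
qed

text \<open>Equality extends by linearity to step functions and by continuity to all of SC(X), where
  these are dense.\<close>

lemma blinfun_sc_eqI:
  fixes \<phi> \<psi> :: "'a::topological_space sc \<Rightarrow>\<^sub>L real"
  assumes "\<And>F. closed F \<Longrightarrow> \<phi> (sc_indicator F) = \<psi> (sc_indicator F)"
  shows "\<phi> = \<psi>"
proof (rule blinfun_eqI)
  fix f
  have step: "\<phi> g = \<psi> g" if "g \<in> sc_step UNIV" for g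
    using that
    by (rule linear_eq_on_span[rotated 3])
      (use assms in \<open>auto intro: bounded_linear.linear blinfun.bounded_linear_right\<close>)
  define K where "K = norm (\<phi> - \<psi>)"
  have "\<bar>\<phi> f - \<psi> f\<bar> \<le> e" if "e > 0" for e
  proof -
    have "e / (K + 1) > 0"
      using that by (simp add: K_def add_nonneg_pos)
    then obtain g where g: "g \<in> sc_step UNIV" "norm (f - g) \<le> e / (K + 1)"
      by (rule sc_step_dense)
    have "\<bar>\<phi> f - \<psi> f\<bar> = norm ((\<phi> - \<psi>) (f - g))"
      using step[OF g(1)] by (simp add: blinfun.diff_right blinfun.diff_left)
    also have "\<dots> \<le> K * norm (f - g)"
      unfolding K_def by (rule norm_blinfun)
    also have "\<dots> \<le> (K + 1) * (e / (K + 1))"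
      using g(2) by (intro mult_mono) (auto simp: K_def)
    also have "\<dots> = e"
      using norm_ge_zero[of "\<phi> - \<psi>"] unfolding K_def by (simp add: add_nonneg_eq_0_iff)
    finally show ?thesis .
  qed
  then have "\<bar>\<phi> f - \<psi> f\<bar> \<le> 0"
    by (meson dense_ge)
  then show "\<phi> f = \<psi> f"
    by simp
qed

section \<open>Functionals as sums of point masses\<close>

text \<open>On generators, multiplying two indicators intersects the sets; the rest is linearity.
  This makes it possible to erase a step function on a closed set.\<close>

lemma sc_step_mult_indicator:
  assumes "f \<in> sc_step E" "closed F"
  obtains g where "g \<in> sc_step E" "\<And>x. apply_sc g x = apply_sc f x * indicator F x"
proof -
  have "\<exists>g\<in>sc_step E. \<forall>x. apply_sc g x = apply_sc f x * indicator F x"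
    using assms(1)
  proof (induction rule: span_induct_alt)
    case base
    then show ?case by (intro bexI[of _ 0]) (auto intro: span_zero)
  next
    case (step c u v)
    then obtain G g where u: "u = sc_indicator G" "closed G" "G \<subseteq> E"
      and g: "g \<in> sc_step E" "\<And>x. apply_sc g x = apply_sc v x * indicator F x"
      by auto
    show ?case
    proof (intro bexI[of _ "c *\<^sub>R sc_indicator (G \<inter> F) + g"] allI)
      show "apply_sc (c *\<^sub>R sc_indicator (G \<inter> F) + g) x = apply_sc (c *\<^sub>R u + v) x * indicator F x" for x
        using u(2) assms(2) by (simp add: u(1) g(2) closed_Int indicator_inter_arith algebra_simps)
      show "c *\<^sub>R sc_indicator (G \<inter> F) + g \<in> sc_step E"
        using u assms(2) by (intro span_add[OF _ g(1)] span_scale span_base) (auto intro: closed_Int)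
    qed
  qed
  then show thesis using that by blast
qed

text \<open>Induction on the number of points. A point with minimal closure is set aside, the others
  are interpolated, and the result is overwritten on that closure by a constant; minimality leaves
  the other points untouched.\<close>

lemma sc_step_interpolation:
  fixes B :: "'a::topological_space set"
  assumes X: "zariski_space (euclidean :: 'a topology)"
    and "finite B" "B \<subseteq> E" "closed E" "\<And>x. \<bar>s x\<bar> \<le> 1"
  obtains f where "f \<in> sc_step E" "\<And>x. \<bar>apply_sc f x\<bar> \<le> 1" "\<And>x. x \<in> B \<Longrightarrow> apply_sc f x = s x"
proof -
  have "\<exists>f\<in>sc_step E. (\<forall>x. \<bar>apply_sc f x\<bar> \<le> 1) \<and> (\<forall>x\<in>B. apply_sc f x = s x)"
    using assms(2,3)
  proof (induction "card B" arbitrary: B)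
    case 0
    then show ?case by (intro bexI[of _ 0]) (auto intro: span_zero)
  next
    case (Suc n)
    have "wf {(A, B :: 'a set). closed A \<and> closed B \<and> A \<subset> B}"
      using X by (intro wf_closed_psubset) (simp add: zariski_space_def)
    then obtain Z where Z: "Z \<in> (\<lambda>x. closure {x}) ` B"
      "\<And>Y. closed Y \<Longrightarrow> Y \<subset> Z \<Longrightarrow> Y \<notin> (\<lambda>x. closure {x}) ` B"
      using Suc(2) by (elim wfE_min'[where Q = "(\<lambda>x. closure {x}) ` B"]) auto
    then obtain x where x: "x \<in> B" "Z = closure {x}"
      by auto
    have not_in: "y \<notin> Z" if "y \<in> B" "y \<noteq> x" for y
      using Z(2)[of "closure {y}"] zariski_closure_singleton_psubset[OF X, of y x] that x(2) by auto
    have "Z \<subseteq> E"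
      unfolding x(2) using x(1) Suc(4) \<open>closed E\<close> by (intro closure_minimal) auto
    have "n = card (B - {x})"
      using Suc(2) x(1) by simp
    moreover have "finite (B - {x})" "B - {x} \<subseteq> E"
      using Suc(3,4) by auto
    ultimately obtain f where f: "f \<in> sc_step E" "\<And>y. \<bar>apply_sc f y\<bar> \<le> 1"
        "\<And>y. y \<in> B - {x} \<Longrightarrow> apply_sc f y = s y"
      using Suc(1)[of "B - {x}"] by blast
    have "closed Z"
      by (simp add: x(2))
    then obtain g where g: "g \<in> sc_step E" "\<And>y. apply_sc g y = apply_sc f y * indicator Z y"
      using sc_step_mult_indicator[OF f(1)] by blast
    \<comment> \<open>\<open>f - g\<close> erases \<open>f\<close> on \<open>Z\<close> and the last
      summand puts \<open>s x\<close> there. Replacing values rather than adding to them preserves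
      the bound 1.\<close>
    show ?case
    proof (intro bexI[of _ "f - g + s x *\<^sub>R sc_indicator Z"] conjI allI ballI)
      have val: "apply_sc (f - g + s x *\<^sub>R sc_indicator Z) y = (if y \<in> Z then s x else apply_sc f y)" for y
        using \<open>closed Z\<close> by (simp add: g(2))
      show "\<bar>apply_sc (f - g + s x *\<^sub>R sc_indicator Z) y\<bar> \<le> 1" for y
        unfolding val using f(2)[of y] assms(5)[of x] by simp
      show "apply_sc (f - g + s x *\<^sub>R sc_indicator Z) y = s y" if "y \<in> B" for y
      proof (cases "y = x")
        case True
        moreover have "x \<in> Z"
          unfolding x(2) using closure_subset by fastforce
        ultimately show ?thesis unfolding val by simp
      next
        case False
        then show ?thesis unfolding val using not_in[OF that] f(3) that by simp
      qed
      show "f - g + s x *\<^sub>R sc_indicator Z \<in> sc_step E"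
        using \<open>closed Z\<close> \<open>Z \<subseteq> E\<close>
        by (intro span_add[OF span_diff[OF f(1) g(1)]] span_scale span_base) auto
    qed
  qed
  then show thesis using that by blast
qed

section \<open>Summable families of point masses\<close>

lemma summable_on_mult_sc:
  assumes "c summable_on E"
  shows "(\<lambda>x. c x * apply_sc f x) summable_on E"
proof -
  have "(\<lambda>x. \<bar>c x\<bar>) summable_on E"
    using assms summable_on_iff_abs_summable_on_real[of c] by simp
  then have "(\<lambda>x. \<bar>c x\<bar> * norm f) summable_on E"
    by (rule summable_on_cmult_left)
  then have "(\<lambda>x. \<bar>c x * apply_sc f x\<bar>) summable_on E"
    by (rule summable_on_comparison_test)
      (auto simp: abs_mult intro!: mult_left_mono abs_apply_sc_le_norm)
  then show ?thesis
    using summable_on_iff_abs_summable_on_real by fastforce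
qed

lemma infsum_mult_indicator:
  fixes c :: "'a \<Rightarrow> real"
  assumes "F \<subseteq> E"
  shows "(\<Sum>\<^sub>\<infinity>x\<in>E. c x * indicator F x) = infsum c F"
  using assms by (intro infsum_cong_neutral) auto

lemma functional_eq_infsum_step:
  fixes \<phi> :: "'a::topological_space sc \<Rightarrow>\<^sub>L real"
  assumes c: "c summable_on E" and \<phi>: "\<And>F. closed F \<Longrightarrow> F \<subseteq> E \<Longrightarrow> \<phi> (sc_indicator F) = infsum c F"
    and "f \<in> sc_step E"
  shows "\<phi> f = (\<Sum>\<^sub>\<infinity>x\<in>E. c x * apply_sc f x)"
  using assms(3)
proof (induction rule: span_induct_alt)
  case base
  then show ?case by (simp add: blinfun.zero_right)
next
  case (step r u v)
  then obtain F where F: "u = sc_indicator F" "closed F" "F \<subseteq> E"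
    by auto
  have "(\<Sum>\<^sub>\<infinity>x\<in>E. c x * apply_sc (r *\<^sub>R u + v) x) =
      (\<Sum>\<^sub>\<infinity>x\<in>E. r * (c x * apply_sc u x) + c x * apply_sc v x)"
    by (simp add: algebra_simps)
  also have "\<dots> = r * (\<Sum>\<^sub>\<infinity>x\<in>E. c x * apply_sc u x) + (\<Sum>\<^sub>\<infinity>x\<in>E. c x * apply_sc v x)"
    by (subst infsum_add)
      (auto simp: infsum_cmult_right' intro!: summable_on_cmult_right summable_on_mult_sc c)
  also have "(\<Sum>\<^sub>\<infinity>x\<in>E. c x * apply_sc u x) = \<phi> u"
    using F by (simp add: \<phi> infsum_mult_indicator)
  finally show ?case
    by (simp add: step blinfun.add_right blinfun.scaleR_right)
qed

(* Test the functional against a step function that equals the sign of c on all but an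
   e-small part of the mass. *)
lemma sum_abs_le_norm_functional:
  fixes \<phi> :: "'a::topological_space sc \<Rightarrow>\<^sub>L real"
  assumes X: "zariski_space (euclidean :: 'a topology)" and "closed E"
    and c: "c summable_on E" and \<phi>: "\<And>F. closed F \<Longrightarrow> F \<subseteq> E \<Longrightarrow> \<phi> (sc_indicator F) = infsum c F"
    and A: "finite A" "A \<subseteq> E"
  shows "(\<Sum>x\<in>A. \<bar>c x\<bar>) \<le> norm \<phi>"
proof -
  have abs: "(\<lambda>x. \<bar>c x\<bar>) summable_on E"
    using c summable_on_iff_abs_summable_on_real[of c] by simp
  \<comment> \<open>The absolute mass outside \<open>B\<close>, at most \<open>e\<close>, is lost
    twice: once in evaluating \<open>\<phi> f\<close>, once in passing from \<open>B\<close> to all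
    of \<open>E\<close>.\<close>
  have *: "(\<Sum>x\<in>A. \<bar>c x\<bar>) \<le> norm \<phi> + 2 * e" if "e > 0" for e
  proof -
    obtain B where B: "finite B" "B \<subseteq> E" "dist (\<Sum>x\<in>B. \<bar>c x\<bar>) (\<Sum>\<^sub>\<infinity>x\<in>E. \<bar>c x\<bar>) \<le> e"
      using infsum_finite_approximation[OF abs \<open>e > 0\<close>] by auto
    obtain f where f: "f \<in> sc_step E" "\<And>x. \<bar>apply_sc f x\<bar> \<le> 1" "\<And>x. x \<in> B \<Longrightarrow> apply_sc f x = sgn (c x)"
      by (rule sc_step_interpolation[OF X B(1,2) \<open>closed E\<close>, of "\<lambda>x. sgn (c x)"])
        (auto simp: abs_sgn_eq)
    have "(\<Sum>\<^sub>\<infinity>x\<in>E. c x * apply_sc f x) =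
        (\<Sum>\<^sub>\<infinity>x\<in>B. c x * apply_sc f x) + (\<Sum>\<^sub>\<infinity>x\<in>E - B. c x * apply_sc f x)"
      using infsum_Un_disjoint[of "\<lambda>x. c x * apply_sc f x" B "E - B"] B(1,2)
      by (simp add: Un_absorb1 summable_on_mult_sc summable_on_subset_banach[OF c])
    also have "(\<Sum>\<^sub>\<infinity>x\<in>B. c x * apply_sc f x) = (\<Sum>x\<in>B. \<bar>c x\<bar>)"
      using B(1) by (auto intro!: sum.cong simp: f(3) abs_sgn)
    finally have 1: "\<phi> f = (\<Sum>x\<in>B. \<bar>c x\<bar>) + (\<Sum>\<^sub>\<infinity>x\<in>E - B. c x * apply_sc f x)"
      using functional_eq_infsum_step[OF c \<phi> f(1)] by simp
    have 2: "(\<Sum>\<^sub>\<infinity>x\<in>E. \<bar>c x\<bar>) = (\<Sum>x\<in>B. \<bar>c x\<bar>) + (\<Sum>\<^sub>\<infinity>x\<in>E - B. \<bar>c x\<bar>)"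
      using infsum_Un_disjoint[of "\<lambda>x. \<bar>c x\<bar>" B "E - B"] B(1,2)
      by (simp add: Un_absorb1 summable_on_subset_banach[OF abs])
    have "\<bar>\<Sum>\<^sub>\<infinity>x\<in>E - B. c x * apply_sc f x\<bar> \<le> (\<Sum>\<^sub>\<infinity>x\<in>E - B. \<bar>c x\<bar>)"
      unfolding real_norm_def[symmetric]
      by (rule norm_infsum_le[OF has_sum_infsum has_sum_infsum])
        (use f(2) in \<open>auto simp: abs_mult mult_left_le intro!: summable_on_mult_sc
          summable_on_subset_banach[OF c] summable_on_subset_banach[OF abs]\<close>)
    moreover have "\<bar>\<phi> f\<bar> \<le> norm \<phi>"
      using norm_blinfun[of \<phi> f] mult_left_mono[OF norm_sc_le[OF f(2)] norm_ge_zero[of \<phi>]] by simp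
    moreover have "(\<Sum>x\<in>A. \<bar>c x\<bar>) \<le> (\<Sum>\<^sub>\<infinity>x\<in>E. \<bar>c x\<bar>)"
      using A by (intro finite_sum_le_infsum abs) auto
    ultimately show ?thesis
      using 1 2 B(3) unfolding dist_real_def by linarith
  qed
  show ?thesis
  proof (rule field_le_epsilon)
    fix e :: real assume "0 < e"
    then show "(\<Sum>x\<in>A. \<bar>c x\<bar>) \<le> norm \<phi> + e"
      using *[of "e / 2"] by simp
  qed
qed

lemma summable_on_real_bounded:
  fixes c :: "'a \<Rightarrow> real"
  assumes "\<And>A. finite A \<Longrightarrow> A \<subseteq> E \<Longrightarrow> (\<Sum>x\<in>A. \<bar>c x\<bar>) \<le> K"
  shows "c summable_on E"
proof -
  have "(\<lambda>x. \<bar>c x\<bar>) summable_on E"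
    using assms by (intro nonneg_bdd_above_summable_on) (auto intro!: bdd_aboveI[of _ K])
  then show ?thesis
    using summable_on_iff_abs_summable_on_real[of c] by simp
qed

(* The masses are forced by Noetherian recursion: a point carries what the closure of the point
   has left after the masses of its proper specialisations. *)
theorem functional_eq_point_masses:
  fixes \<phi> :: "'a::topological_space sc \<Rightarrow>\<^sub>L real"
  assumes X: "zariski_space (euclidean :: 'a topology)"
  shows "\<exists>c. c summable_on UNIV \<and> (\<forall>A. finite A \<longrightarrow> (\<Sum>x\<in>A. \<bar>c x\<bar>) \<le> norm \<phi>) \<and>
    (\<forall>E. closed E \<longrightarrow> \<phi> (sc_indicator E) = infsum c E)"
proof -
  have noeth: "noetherian_space (euclidean :: 'a topology)"
    using X by (simp add: zariski_space_def)
  define r where "r = inv_image {(A, B :: 'a set). closed A \<and> closed B \<and> A \<subset> B} (\<lambda>x. closure {x})"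
  have "wf r"
    unfolding r_def by (intro wf_inv_image wf_closed_psubset noeth)
  \<comment> \<open>\<open>infsum\<close> is 0 on a family that is not summable, so the recursion
    makes sense before summability is known.\<close>
  define c where "c = wfrec r (\<lambda>c x. \<phi> (sc_indicator (closure {x})) - infsum c (closure {x} - {x}))"
  have c: "c x = \<phi> (sc_indicator (closure {x})) - infsum c (closure {x} - {x})" for x
  proof -
    \<comment> \<open>The recursive calls concern proper specialisations of \<open>x\<close>, whose
      closures are strictly smaller, so \<open>cut\<close> changes nothing.\<close>
    have "infsum (cut c r x) (closure {x} - {x}) = infsum c (closure {x} - {x})"
      using zariski_closure_singleton_psubset[OF X, of _ x]
      by (intro infsum_cong cut_apply) (auto simp: r_def)
    then show ?thesis
      unfolding c_def by (subst wfrec[OF \<open>wf r\<close>]) simp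
  qed
  have main: "c summable_on E \<and> \<phi> (sc_indicator E) = infsum c E" if "closed E" for E
    using noeth that
  proof (induction E rule: noetherian_closed_induct)
    case empty
    then show ?case by (simp add: blinfun.zero_right)
  next
    case (irreducible E)
    then obtain x where x: "x \<in> E" "closure {x} = E"
      using X unfolding zariski_space_def by (metis euclidean_closure_of)
    \<comment> \<open>A finite set of points other than the generic one lies in a finite union of
      proper point closures, which is proper by irreducibility. The induction hypothesis there
      yields the bound \<open>norm \<phi>\<close>, independent of the finite set.\<close>
    have "c summable_on (E - {x})"
    proof (rule summable_on_real_bounded)
      fix A assume A: "finite A" "A \<subseteq> E - {x}"
      define Z where "Z = (\<Union>y\<in>A. closure {y})"
      have "Z \<subset> E"
        unfolding Z_def
        by (rule irreducible_closedin_Union[OF irreducible(1,3)])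
          (use A zariski_closure_singleton_psubset[OF X, of _ x] x in auto)
      moreover have "closed Z"
        unfolding Z_def using A(1) by (intro closed_UN) auto
      moreover have "A \<subseteq> Z"
        unfolding Z_def using closure_subset by fastforce
      ultimately show "(\<Sum>y\<in>A. \<bar>c y\<bar>) \<le> norm \<phi>"
        using irreducible.IH A(1) by (intro sum_abs_le_norm_functional[OF X, of Z]) auto
    qed
    moreover have "E = insert x (E - {x})"
      using x by auto
    ultimately have "c summable_on E" "infsum c E = c x + infsum c (E - {x})"
      using infsum_insert[of c "E - {x}" x] summable_on_insert_iff[of c x "E - {x}"] by auto
    then show ?case
      using c[of x] x by simp
  next
    case (Un A B)
    then have "infsum c (A \<union> B) = infsum c A + infsum c B - infsum c (A \<inter> B)"
      by (intro infsum_Un_Int) (auto intro: summable_on_subset_banach)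
    then show ?case
      using Un by (simp add: sc_indicator_Un blinfun.add_right blinfun.diff_right summable_on_union)
  qed
  moreover have "(\<Sum>x\<in>A. \<bar>c x\<bar>) \<le> norm \<phi>" if "finite A" for A
    using main that by (intro sum_abs_le_norm_functional[OF X closed_UNIV]) auto
  ultimately show ?thesis
    by blast
qed

section \<open>Surjectivity of the integration map\<close>

text \<open>Jordan decomposition by exchanging \<open>B\<close> with \<open>A - B\<close>: since
  \<open>\<mu> B = \<mu> A - \<mu> (A - B)\<close>, maximising \<open>\<mu>\<close> over subsets of
  \<open>A\<close> amounts to maximising \<open>- \<mu>\<close> over their complements in
  \<open>A\<close>.\<close>

lemma measure_pos_minus_neg_variation:
  assumes \<mu>: "finite_signed_borel \<mu>" and A: "A \<in> sets borel"
  shows "measure (pos_variation \<mu>) A - measure (neg_variation \<mu>) A = \<mu> A"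
proof -
  interpret pos: finite_measure "pos_variation \<mu>"
    using \<mu> by (rule finite_measure_pos_variation)
  interpret neg: finite_measure "neg_variation \<mu>"
    unfolding neg_variation_def by (intro finite_measure_pos_variation finite_signed_borel_uminus \<mu>)
  have \<mu>_empty: "\<mu> {} = 0"
    using \<mu> by (simp add: finite_signed_borel_def)
  have pos_ge: "\<mu> B \<le> measure (pos_variation \<mu>) A" if "B \<in> sets borel" "B \<subseteq> A" for B
  proof -
    have "ennreal (\<mu> B) \<le> emeasure (pos_variation \<mu>) A"
      unfolding emeasure_pos_variation[OF \<mu> A] using that by (intro SUP_upper) auto
    then show ?thesis
      using ennreal_le_iff[OF measure_nonneg] by (simp add: pos.emeasure_eq_measure)
  qed
  have neg_ge: "- \<mu> B \<le> measure (neg_variation \<mu>) A" if "B \<in> sets borel" "B \<subseteq> A" for B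
  proof -
    have "ennreal (- \<mu> B) \<le> emeasure (neg_variation \<mu>) A"
      unfolding neg_variation_def emeasure_pos_variation[OF finite_signed_borel_uminus[OF \<mu>] A]
      using that by (intro SUP_upper) auto
    then show ?thesis
      using ennreal_le_iff[OF measure_nonneg] by (simp add: neg.emeasure_eq_measure)
  qed
  have split: "\<mu> A = \<mu> B + \<mu> (A - B)" if "B \<in> sets borel" "B \<subseteq> A" for B
    using finite_signed_borel_Un[OF \<mu> that(1), of "A - B"] that A by (simp add: Un_absorb1 sets.Diff)
  have "measure (pos_variation \<mu>) A \<le> \<mu> A + measure (neg_variation \<mu>) A"
  proof -
    \<comment> \<open>\<open>ennreal\<close> truncates negative numbers, so the bound must be known
      to be nonnegative before it is carried back to the reals.\<close>
    have "0 \<le> \<mu> A + measure (neg_variation \<mu>) A"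
      using neg_ge[OF A] by simp
    moreover have "emeasure (pos_variation \<mu>) A \<le> ennreal (\<mu> A + measure (neg_variation \<mu>) A)"
      unfolding emeasure_pos_variation[OF \<mu> A]
    proof (intro SUP_least ennreal_leI)
      fix B assume "B \<in> {B \<in> sets borel. B \<subseteq> A}"
      then show "\<mu> B \<le> \<mu> A + measure (neg_variation \<mu>) A"
        using neg_ge[of "A - B"] split[of B] A by auto
    qed
    ultimately show ?thesis
      by (simp add: pos.emeasure_eq_measure)
  qed
  moreover have "measure (neg_variation \<mu>) A \<le> measure (pos_variation \<mu>) A - \<mu> A"
  proof -
    have "0 \<le> measure (pos_variation \<mu>) A - \<mu> A"
      using pos_ge[OF A] by simp
    moreover have "emeasure (neg_variation \<mu>) A \<le> ennreal (measure (pos_variation \<mu>) A - \<mu> A)"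
      unfolding neg_variation_def emeasure_pos_variation[OF finite_signed_borel_uminus[OF \<mu>] A]
    proof (intro SUP_least ennreal_leI)
      fix B assume "B \<in> {B \<in> sets borel. B \<subseteq> A}"
      then show "- \<mu> B \<le> measure (pos_variation \<mu>) A - \<mu> A"
        using pos_ge[of "A - B"] split[of B] A by auto
    qed
    ultimately show ?thesis
      by (simp add: neg.emeasure_eq_measure)
  qed
  ultimately show ?thesis by simp
qed

lemma integration_map_indicator:
  assumes "closed F"
  shows "integration_map \<mu> (sc_indicator F) = smeasure \<mu> F"
proof -
  have "finite_signed_borel (smeasure \<mu>)"
    using smeasure[of \<mu>] by simp
  moreover have "F \<in> sets borel"
    using assms by simp
  ultimately show ?thesis
    using measure_pos_minus_neg_variation[of "smeasure \<mu>" F] assms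
    by (simp add: integration_map.rep_eq neg_variation_def)
qed

text \<open>Countable additivity is the regrouping of an absolutely convergent sum. Off the Borel
  sets the value 0 is forced by \<open>finite_signed_borel\<close>.\<close>

lemma finite_signed_borel_point_masses:
  fixes c :: "'a::topological_space \<Rightarrow> real"
  assumes c: "c summable_on UNIV"
  shows "finite_signed_borel (\<lambda>B. if B \<in> sets borel then infsum c B else 0)"
  unfolding finite_signed_borel_def
proof (intro conjI allI impI)
  fix A :: "nat \<Rightarrow> 'a set"
  assume A: "range A \<subseteq> sets borel \<and> disjoint_family A"
  \<comment> \<open>Disjointness makes \<open>snd\<close> a bijection from the tagged points onto
    the union, so the sum over the union becomes a double sum.\<close>
  have inj: "inj_on snd (Sigma UNIV A)"
    using A by (auto simp: inj_on_def disjoint_family_on_def)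
  have snd: "snd ` Sigma UNIV A = (\<Union>n. A n)"
    by force
  have "(c has_sum infsum c (\<Union>n. A n)) (\<Union>n. A n)"
    using c by (intro has_sum_infsum summable_on_subset_banach[OF c]) auto
  then have "((\<lambda>p. c (snd p)) has_sum infsum c (\<Union>n. A n)) (Sigma UNIV A)"
    using has_sum_reindex[OF inj, of c] by (simp add: snd o_def)
  then have "((\<lambda>n. infsum c (A n)) has_sum infsum c (\<Union>n. A n)) UNIV"
    by (rule has_sum_Sigma') (auto intro!: has_sum_infsum summable_on_subset_banach[OF c])
  then have "(\<lambda>n. infsum c (A n)) sums infsum c (\<Union>n. A n)"
    by (rule has_sum_imp_sums)
  moreover have "A n \<in> sets borel" "(\<Union>n. A n) \<in> sets borel" for n
    using A by auto
  ultimately show "(\<lambda>n. if A n \<in> sets borel then infsum c (A n) else 0) sums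
      (if (\<Union>n. A n) \<in> sets borel then infsum c (\<Union>n. A n) else 0)"
    by simp
qed auto

text \<open>The point masses of a functional form a measure whose integration functional agrees with
  it on indicators of closed sets, and these values determine a functional.\<close>

lemma surj_integration_map:
  assumes X: "zariski_space (euclidean :: 'a::topological_space topology)"
  shows "surj (integration_map :: 'a signed_measure \<Rightarrow> _)"
  unfolding surj_def
proof
  fix \<phi> :: "'a sc \<Rightarrow>\<^sub>L real"
  obtain c where c: "c summable_on UNIV" "\<forall>E. closed E \<longrightarrow> \<phi> (sc_indicator E) = infsum c E"
    using functional_eq_point_masses[OF X, of \<phi>] by auto
  define \<mu> where "\<mu> = Abs_signed_measure (\<lambda>B. if B \<in> sets borel then infsum c B else 0)"
  have "smeasure \<mu> B = (if B \<in> sets borel then infsum c B else 0)" for B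
    unfolding \<mu>_def using finite_signed_borel_point_masses[OF c(1)]
    by (simp add: Abs_signed_measure_inverse)
  then have "integration_map \<mu> = \<phi>"
    by (intro blinfun_sc_eqI) (simp add: integration_map_indicator c(2))
  then show "\<exists>\<mu>. \<phi> = integration_map \<mu>"
    by metis
qed

section \<open>Subsequences converging on closed sets\<close>

text \<open>What the subsequence argument retains of a bounded sequence of nonnegative measures: the
  values on closed sets, with modularity in place of additivity. Monotonicity can fail for signed
  masses, hence their later split into two parts.\<close>

locale bounded_valuations =
  fixes N :: "nat \<Rightarrow> 'a::topological_space set \<Rightarrow> real" and R :: real
  assumes noeth: "noetherian_space (euclidean :: 'a topology)"
    and nonneg: "closed A \<Longrightarrow> 0 \<le> N n A"
    and le_bound: "closed A \<Longrightarrow> N n A \<le> R"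
    and N_empty: "N n {} = 0"
    and modular: "closed A \<Longrightarrow> closed B \<Longrightarrow> N n (A \<union> B) = N n A + N n B - N n (A \<inter> B)"
    and mono: "closed A \<Longrightarrow> closed B \<Longrightarrow> A \<subseteq> B \<Longrightarrow> N n A \<le> N n B"
begin

definition converges :: "(nat \<Rightarrow> nat) \<Rightarrow> 'a set \<Rightarrow> bool" where
  "converges s E \<longleftrightarrow> (\<forall>F. closed F \<and> F \<subseteq> E \<longrightarrow> convergent (\<lambda>k. N (s k) F))"

text \<open>The threshold index may depend on \<open>Z\<close>: \<open>a\<close> bounds the limsup
  of the mass on each proper closed subset separately, without uniformity.\<close>

definition eventually_bounded :: "'a set \<Rightarrow> (nat \<Rightarrow> nat) \<Rightarrow> real \<Rightarrow> bool" where
  "eventually_bounded E s a \<longleftrightarrow>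
     (\<forall>Z e. closed Z \<and> Z \<subset> E \<and> e > 0 \<longrightarrow> (\<forall>\<^sub>F k in sequentially. N (s k) Z < a + e))"

lemma convergent_subseq:
  assumes "strict_mono r" "convergent (\<lambda>k. f (s k))"
  shows "convergent (\<lambda>k. f ((s \<circ> r) k))"
  using convergent_subseq_convergent[OF assms(2,1)] by (simp add: o_def)

lemma converges_subseq: "strict_mono r \<Longrightarrow> converges s E \<Longrightarrow> converges (s \<circ> r) E"
  unfolding converges_def using convergent_subseq[of r "\<lambda>k. N k _"] by blast

lemma eventually_bounded_subseq:
  assumes "strict_mono r" "eventually_bounded E s a"
  shows "eventually_bounded E (s \<circ> r) a"
  using assms eventually_subseq[OF assms(1)] unfolding eventually_bounded_def o_def by blast

lemma closed_convergent_subseq: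
  fixes s :: "nat \<Rightarrow> nat"
  assumes "closed E"
  obtains r where "strict_mono r" "convergent (\<lambda>k. N (s (r k)) E)"
proof -
  have "bounded (range (\<lambda>k. N (s k) E))"
    using nonneg[OF assms] le_bound[OF assms] by (auto intro!: boundedI[of _ R])
  then obtain l r where "strict_mono r" "((\<lambda>k. N (s k) E) \<circ> r) \<longlonglongrightarrow> l"
    using bounded_imp_convergent_subsequence[of "\<lambda>k. N (s k) E"] by blast
  then show thesis
    using that by (auto simp: convergent_def o_def)
qed

(* The infimum of the eventual bounds over all subsequences is nearly attained; below it, some
   proper closed set must carry more infinitely often. *)
lemma near_optimal_subseq:
  fixes s :: "nat \<Rightarrow> nat"
  assumes E: "E \<noteq> {}" and IH: "\<And>F s. closed F \<Longrightarrow> F \<subset> E \<Longrightarrow> strict_mono (s :: nat \<Rightarrow> nat) \<Longrightarrow>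
      \<exists>r. strict_mono r \<and> converges (s \<circ> r) F"
    and s: "strict_mono s" and e: "e > 0"
  obtains r Z a where "strict_mono r" "closed Z" "Z \<subset> E" "converges (s \<circ> r) Z"
    "eventually_bounded E (s \<circ> r) a" "\<And>k. a - e \<le> N (s (r k)) Z"
proof -
  \<comment> \<open>\<open>Inf A\<close> is the quantity to be nearly attained; \<open>R\<close>
    will show that \<open>A\<close> is nonempty, and the empty set that 0 is a lower bound.\<close>
  define A where "A = {a. \<exists>r. strict_mono r \<and> eventually_bounded E (s \<circ> r) a}"
  have "N n Z < R + d" if "closed Z" "d > 0" for n Z d
    using le_bound[OF that(1), of n] that(2) by linarith
  then have "eventually_bounded E (s \<circ> id) R"
    unfolding eventually_bounded_def by (auto intro: always_eventually)
  then have "R \<in> A"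
    unfolding A_def using strict_mono_id by blast
  have A_nonneg: "0 \<le> a" if a: "a \<in> A" for a
  proof (rule ccontr)
    assume "\<not> 0 \<le> a"
    moreover obtain r where "eventually_bounded E (s \<circ> r) a"
      using a by (auto simp: A_def)
    \<comment> \<open>Tested on the empty set, a proper subset of \<open>E\<close>, with tolerance
      \<open>- a\<close>, the bound would give 0 < 0.\<close>
    ultimately have "\<forall>\<^sub>F k in sequentially. N ((s \<circ> r) k) {} < a + (- a)"
      using E unfolding eventually_bounded_def by (metis closed_empty neg_0_less_iff_less not_le psubsetI empty_subsetI)
    then show False
      by (simp add: N_empty)
  qed
  then have bdd: "bdd_below A"
    unfolding bdd_below_def by blast
  obtain a where a: "a \<in> A" "a < Inf A + e"
    using cInf_lessD[of A "Inf A + e"] \<open>R \<in> A\<close> e by auto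
  then obtain r where r: "strict_mono r" "eventually_bounded E (s \<circ> r) a"
    by (auto simp: A_def)
  \<comment> \<open>\<open>a\<close> lies within \<open>e\<close> of the infimum, so no subsequence,
    in particular not \<open>s \<circ> r\<close>, admits the bound \<open>a - e\<close>.\<close>
  have "a - e \<notin> A"
    using cInf_lower[OF _ bdd, of "a - e"] a(2) by auto
  then have "\<not> eventually_bounded E (s \<circ> r) (a - e)"
    using r(1) by (auto simp: A_def)
  then obtain Z d where Z: "closed Z" "Z \<subset> E" "d > 0"
      "\<not> (\<forall>\<^sub>F k in sequentially. N ((s \<circ> r) k) Z < a - e + d)"
    unfolding eventually_bounded_def by blast
  have "infinite {k. N ((s \<circ> r) k) Z \<ge> a - e}"
  proof
    assume "finite {k. N ((s \<circ> r) k) Z \<ge> a - e}"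
    then have "\<forall>\<^sub>F k in sequentially. \<not> N ((s \<circ> r) k) Z \<ge> a - e"
      unfolding cofinite_eq_sequentially[symmetric] eventually_cofinite by simp
    then have "\<forall>\<^sub>F k in sequentially. N ((s \<circ> r) k) Z < a - e + d"
      by eventually_elim (use Z(3) in linarith)
    then show False
      using Z(4) by blast
  qed
  \<comment> \<open>Enumerating these indices turns "infinitely often" into "always", which further
    subsequences inherit.\<close>
  from infinite_enumerate[OF this] obtain q :: "nat \<Rightarrow> nat"
    where q: "strict_mono q" "\<forall>k. N ((s \<circ> r) (q k)) Z \<ge> a - e"
    by auto
  have "strict_mono (s \<circ> r \<circ> q)"
    using s r(1) q(1) by (intro strict_mono_o)
  then obtain p where p: "strict_mono p" "converges (s \<circ> r \<circ> q \<circ> p) Z"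
    using IH[OF Z(1,2)] by blast
  show thesis
  proof
    show "strict_mono (r \<circ> q \<circ> p)"
      using r(1) q(1) p(1) by (intro strict_mono_o)
    show "converges (s \<circ> (r \<circ> q \<circ> p)) Z"
      using p(2) by (simp add: o_assoc)
    have "eventually_bounded E (s \<circ> r \<circ> (q \<circ> p)) a"
      using eventually_bounded_subseq[OF strict_mono_o[OF q(1) p(1)] r(2)] .
    then show "eventually_bounded E (s \<circ> (r \<circ> q \<circ> p)) a"
      by (simp add: o_assoc)
    show "a - e \<le> N (s ((r \<circ> q \<circ> p) k)) Z" for k
      using q(2) by simp
  qed (use Z in auto)
qed

text \<open>For a proper closed \<open>W\<close>, irreducibility keeps \<open>W \<union> Z\<close>
  proper, so its mass eventually exceeds that of \<open>Z\<close> only slightly. By modularity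
  \<open>W\<close> then has little mass beyond \<open>W \<inter> Z\<close>, where convergence is
  known; hence the masses of \<open>W\<close> are Cauchy.\<close>

lemma converges_of_near_optimal:
  assumes E: "irreducible_closedin euclidean E" "convergent (\<lambda>k. N (s k) E)"
    and opt: "\<And>e. e > 0 \<Longrightarrow> \<exists>Z a. closed Z \<and> Z \<subset> E \<and> converges s Z \<and> eventually_bounded E s a \<and>
        (\<forall>\<^sub>F k in sequentially. a - e \<le> N (s k) Z)"
  shows "converges s E"
  unfolding converges_def
proof (intro allI impI)
  fix W assume W: "closed W \<and> W \<subseteq> E"
  show "convergent (\<lambda>k. N (s k) W)"
  proof (cases "W = E")
    case True
    then show ?thesis using E(2) by simp
  next
    case False
    have "Cauchy (\<lambda>k. N (s k) W)"
    proof (rule metric_CauchyI)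
      fix e :: real assume "e > 0"
      then obtain Z a where Z: "closed Z" "Z \<subset> E" "converges s Z" "eventually_bounded E s a"
          "\<forall>\<^sub>F k in sequentially. a - e / 8 \<le> N (s k) Z"
        using opt[of "e / 8"] by auto
      have "W \<union> Z \<subset> E"
        using irreducible_closedin_Un[OF E(1)] W Z(1,2) False by blast
      then have "\<forall>\<^sub>F k in sequentially. N (s k) (W \<union> Z) < a + e / 8"
        using Z(1,4) W \<open>e > 0\<close> unfolding eventually_bounded_def
        by (metis closed_Un divide_pos_pos zero_less_numeral)
      (* N W - N (W Int Z) = N (W Un Z) - N Z is eventually below e/4. *)
      then have "\<forall>\<^sub>F k in sequentially. N (s k) W - N (s k) (W \<inter> Z) < e / 4"
        using Z(5)
      proof eventually_elim
        case (elim k)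
        then show ?case using modular[of W Z "s k"] W Z(1) by auto
      qed
      then obtain K where K: "\<And>k. k \<ge> K \<Longrightarrow> N (s k) W - N (s k) (W \<inter> Z) < e / 4"
        unfolding eventually_sequentially by auto
      have ge: "N (s k) (W \<inter> Z) \<le> N (s k) W" for k
        using W Z(1) by (intro mono) auto
      have "closed (W \<inter> Z)"
        using W Z(1) by auto
      then have "convergent (\<lambda>k. N (s k) (W \<inter> Z))"
        using Z(3) unfolding converges_def by auto
      then obtain L where L: "\<And>m n. m \<ge> L \<Longrightarrow> n \<ge> L \<Longrightarrow> dist (N (s m) (W \<inter> Z)) (N (s n) (W \<inter> Z)) < e / 4"
        using metric_CauchyD[OF convergent_Cauchy, of _ "e / 4"] \<open>e > 0\<close> by (metis divide_pos_pos zero_less_numeral)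
      show "\<exists>M. \<forall>m\<ge>M. \<forall>n\<ge>M. dist (N (s m) W) (N (s n) W) < e"
      proof (intro exI[of _ "max K L"] allI impI)
        fix m n assume "max K L \<le> m" "max K L \<le> n"
        then have "N (s m) W - N (s m) (W \<inter> Z) < e / 4" "N (s n) W - N (s n) (W \<inter> Z) < e / 4"
          "\<bar>N (s m) (W \<inter> Z) - N (s n) (W \<inter> Z)\<bar> < e / 4"
          using K L[of m n] by (auto simp: dist_real_def)
        then show "dist (N (s m) W) (N (s n) W) < e"
          using ge[of m] ge[of n] unfolding dist_real_def by linarith
      qed
    qed
    then show ?thesis
      by (rule Cauchy_convergent)
  qed
qed

text \<open>For irreducible \<open>E\<close> a diagonal sequence is near-optimal for every tolerance
  at once; for a union the two parts are treated in succession and combined by modularity.\<close>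

lemma exists_converges_subseq:
  fixes s :: "nat \<Rightarrow> nat"
  assumes "closed E" "strict_mono s"
  shows "\<exists>r. strict_mono r \<and> converges (s \<circ> r) E"
  using noeth assms
proof (induction E arbitrary: s rule: noetherian_closed_induct)
  case (empty s)
  have "convergent (\<lambda>k. N (s k) {})"
    by (simp add: N_empty convergent_const)
  then show ?case
    by (intro exI[of _ id]) (auto simp: converges_def strict_mono_def)
next
  case (irreducible E s)
  \<comment> \<open>\<open>E\<close> itself is treated first, since the near-optimal sets are all
    proper subsets of it.\<close>
  obtain q where q: "strict_mono q" "convergent (\<lambda>k. N (s (q k)) E)"
    using closed_convergent_subseq[OF irreducible(2)] by blast
  \<comment> \<open>Stage \<open>n\<close> demands tolerance 1/(n+1); the witnesses \<open>Z\<close>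
    and \<open>a\<close> may differ from stage to stage.\<close>
  define good where "good n u \<longleftrightarrow> (\<exists>Z a. closed Z \<and> Z \<subset> E \<and> converges (s \<circ> q \<circ> u) Z \<and>
      eventually_bounded E (s \<circ> q \<circ> u) a \<and>
      (\<forall>k. a - inverse (real (Suc n)) \<le> N ((s \<circ> q \<circ> u) k) Z))" for n u
  interpret subseqs good
  proof
    fix n and u :: "nat \<Rightarrow> nat" assume "strict_mono u"
    then have mono: "strict_mono (s \<circ> q \<circ> u)"
      using irreducible.prems q(1) by (intro strict_mono_o)
    have pos: "0 < inverse (real (Suc n))"
      by simp
    show "\<exists>r. strict_mono r \<and> good n (u \<circ> r)"
    proof (rule near_optimal_subseq[OF irreducible(3) irreducible.IH mono pos])
      fix r Z a
      assume "strict_mono r" "closed Z" "Z \<subset> E" "converges (s \<circ> q \<circ> u \<circ> r) Z"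
        "eventually_bounded E (s \<circ> q \<circ> u \<circ> r) a"
        "\<And>k. a - inverse (real (Suc n)) \<le> N ((s \<circ> q \<circ> u) (r k)) Z"
      then show ?thesis
        unfolding good_def o_assoc comp_apply by blast
    qed
  qed
  define d where "d = s \<circ> q \<circ> diagseq"
  \<comment> \<open>Stability under subsequences lets each stage survive the later extractions of
    the diagonal process.\<close>
  have good_subseq: "good n (u \<circ> r)" if r: "strict_mono r" and good: "good n u" for n u r
  proof -
    obtain Z a where "closed Z" "Z \<subset> E" "converges (s \<circ> q \<circ> u) Z"
        "eventually_bounded E (s \<circ> q \<circ> u) a"
        "\<forall>k. a - inverse (real (Suc n)) \<le> N ((s \<circ> q \<circ> u) k) Z"
      using good unfolding good_def by blast
    then show ?thesis
      using converges_subseq[OF r, of "s \<circ> q \<circ> u" Z] eventually_bounded_subseq[OF r, of E "s \<circ> q \<circ> u" a]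
      unfolding good_def o_assoc comp_apply by blast
  qed
  have "converges d E"
  proof (rule converges_of_near_optimal[OF irreducible(1)])
    show "convergent (\<lambda>k. N (d k) E)"
      using convergent_subseq[OF subseq_diagseq, of "\<lambda>k. N k E" "s \<circ> q"] q(2) by (simp add: d_def)
    fix e :: real assume "e > 0"
    then obtain n where n: "inverse (real (Suc n)) < e"
      using reals_Archimedean by blast
    \<comment> \<open>Stage \<open>n\<close> is available for the diagonal sequence after its first
      \<open>Suc n\<close> terms are dropped; the shift is removed below, because convergence and
      eventual bounds ignore initial segments.\<close>
    have "good n (diagseq \<circ> (+) (Suc n))"
      by (rule diagseq_holds) (rule good_subseq)
    then obtain Z a where Z: "closed Z" "Z \<subset> E"
        "converges (d \<circ> (+) (Suc n)) Z" "eventually_bounded E (d \<circ> (+) (Suc n)) a"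
        "\<And>k. a - inverse (real (Suc n)) \<le> N ((d \<circ> (+) (Suc n)) k) Z"
      unfolding good_def d_def o_assoc by blast
    have shift: "(d \<circ> (+) (Suc n)) k = d (k + Suc n)" for k
      by (simp add: add.commute)
    show "\<exists>Z a. closed Z \<and> Z \<subset> E \<and> converges d Z \<and> eventually_bounded E d a \<and>
        (\<forall>\<^sub>F k in sequentially. a - e \<le> N (d k) Z)"
    proof (intro exI[of _ Z] exI[of _ a] conjI Z(1,2))
      show "converges d Z"
        using Z(3) convergent_ignore_initial_segment[of "\<lambda>k. N (d k) _" "Suc n"]
        unfolding converges_def shift by blast
      show "eventually_bounded E d a"
        using Z(4) eventually_sequentially_seg[of "\<lambda>k. N (d k) _ < _" "Suc n"]
        unfolding eventually_bounded_def shift by blast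
      have "\<forall>\<^sub>F k in sequentially. a - e \<le> N (d (k + Suc n)) Z"
      proof (rule always_eventually, rule allI)
        show "a - e \<le> N (d (k + Suc n)) Z" for k
          using Z(5)[of k] n unfolding shift by linarith
      qed
      then show "\<forall>\<^sub>F k in sequentially. a - e \<le> N (d k) Z"
        using eventually_sequentially_seg[of "\<lambda>k. a - e \<le> N (d k) Z" "Suc n"] by simp
    qed
  qed
  then show ?case
    unfolding d_def comp_assoc using strict_mono_o[OF q(1) subseq_diagseq] by blast
next
  case (Un A B s)
  obtain r where r: "strict_mono r" "converges (s \<circ> r) A"
    using Un by blast
  then obtain q where q: "strict_mono q" "converges (s \<circ> r \<circ> q) B"
    using Un.IH(2)[of "s \<circ> r"] Un.prems strict_mono_o by blast
  have A: "converges (s \<circ> r \<circ> q) A"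
    using converges_subseq[OF q(1) r(2)] .
  have "converges (s \<circ> r \<circ> q) (A \<union> B)"
    unfolding converges_def
  proof (intro allI impI)
    fix F assume F: "closed F \<and> F \<subseteq> A \<union> B"
    then have cl: "closed (F \<inter> A)" "closed (F \<inter> B)" "closed (F \<inter> A \<inter> (F \<inter> B))"
      using Un(1,2) by auto
    have "F = F \<inter> A \<union> F \<inter> B"
      using F by auto
    then have "N k F = N k (F \<inter> A) + N k (F \<inter> B) - N k (F \<inter> A \<inter> (F \<inter> B))" for k
      using modular[OF cl(1,2)] by metis
    moreover have "convergent (\<lambda>k. N ((s \<circ> r \<circ> q) k) (F \<inter> A))"
      "convergent (\<lambda>k. N ((s \<circ> r \<circ> q) k) (F \<inter> A \<inter> (F \<inter> B)))"
      "convergent (\<lambda>k. N ((s \<circ> r \<circ> q) k) (F \<inter> B))"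
      using A q(2) cl unfolding converges_def by (meson inf_le1 inf_le2 order_trans)+
    ultimately show "convergent (\<lambda>k. N ((s \<circ> r \<circ> q) k) F)"
      by (auto intro: convergent_add convergent_diff)
  qed
  then show ?case
    unfolding comp_assoc using strict_mono_o[OF r(1) q(1)] by blast
qed

end

section \<open>Weak sequential convergence\<close>

lemma bounded_valuations_infsum:
  fixes c :: "nat \<Rightarrow> 'a::topological_space \<Rightarrow> real"
  assumes noeth: "noetherian_space (euclidean :: 'a topology)"
    and c: "\<And>n x. 0 \<le> c n x" "\<And>n A. finite A \<Longrightarrow> sum (c n) A \<le> R"
  shows "bounded_valuations (\<lambda>n. infsum (c n)) R"
proof
  have summable: "c n summable_on A" for n A
    using c by (intro summable_on_real_bounded[of A "c n" R]) simp
  fix n and A B :: "'a set"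
  show "0 \<le> infsum (c n) A"
    by (intro infsum_nonneg c)
  show "infsum (c n) A \<le> R"
    by (intro infsum_le_finite_sums summable c)
  show "infsum (c n) (A \<union> B) = infsum (c n) A + infsum (c n) B - infsum (c n) (A \<inter> B)"
    by (intro infsum_Un_Int summable)
  show "infsum (c n) A \<le> infsum (c n) B" if "A \<subseteq> B"
    using that by (intro infsum_mono2 summable c)
qed (use noeth in auto)

text \<open>Two successive extractions, first for the positive and then for the negative parts of
  the masses, make both converge on every closed set; the functional on an indicator is their
  difference.\<close>

lemma functionals_subseq_convergent_on_indicators:
  fixes \<phi> :: "nat \<Rightarrow> 'a::topological_space sc \<Rightarrow>\<^sub>L real"
  assumes X: "zariski_space (euclidean :: 'a topology)" and R: "\<And>n. norm (\<phi> n) \<le> R"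
  obtains r where "strict_mono r" "\<And>F. closed F \<Longrightarrow> convergent (\<lambda>k. \<phi> (r k) (sc_indicator F))"
proof -
  have noeth: "noetherian_space (euclidean :: 'a topology)"
    using X by (simp add: zariski_space_def)
  have "\<forall>n. \<exists>c. c summable_on UNIV \<and> (\<forall>A. finite A \<longrightarrow> (\<Sum>x\<in>A. \<bar>c x\<bar>) \<le> norm (\<phi> n)) \<and>
      (\<forall>E. closed E \<longrightarrow> \<phi> n (sc_indicator E) = infsum c E)"
    using functional_eq_point_masses[OF X] by blast
  from choice[OF this] obtain c where
    c: "\<And>n. c n summable_on UNIV" "\<And>n A. finite A \<Longrightarrow> (\<Sum>x\<in>A. \<bar>c n x\<bar>) \<le> norm (\<phi> n)"
      "\<And>n E. closed E \<Longrightarrow> \<phi> n (sc_indicator E) = infsum (c n) E"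
    by metis
  define p where "p n x = max 0 (c n x)" for n x
  define m where "m n x = max 0 (- c n x)" for n x
  have bound: "sum (p n) A \<le> R" "sum (m n) A \<le> R" if "finite A" for n A
  proof -
    have "sum (p n) A \<le> (\<Sum>x\<in>A. \<bar>c n x\<bar>)" "sum (m n) A \<le> (\<Sum>x\<in>A. \<bar>c n x\<bar>)"
      by (intro sum_mono; simp add: p_def m_def)+
    then show "sum (p n) A \<le> R" "sum (m n) A \<le> R"
      using c(2)[OF that, of n] R[of n] by linarith+
  qed
  have nonneg: "0 \<le> p n x" "0 \<le> m n x" for n x
    by (auto simp: p_def m_def)
  have summable: "p n summable_on F" "m n summable_on F" for n F
    using bound nonneg by (auto intro!: summable_on_real_bounded[of F _ R])
  interpret P: bounded_valuations "\<lambda>n. infsum (p n)" R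
    by (rule bounded_valuations_infsum[OF noeth nonneg(1) bound(1)])
  interpret M: bounded_valuations "\<lambda>n. infsum (m n)" R
    by (rule bounded_valuations_infsum[OF noeth nonneg(2) bound(2)])
  obtain q where q: "strict_mono q" "P.converges (id \<circ> q) UNIV"
    using P.exists_converges_subseq[OF closed_UNIV strict_mono_on_id] by blast
  obtain r where r: "strict_mono r" "M.converges (q \<circ> r) UNIV"
    using M.exists_converges_subseq[OF closed_UNIV q(1)] by blast
  have "P.converges (id \<circ> q \<circ> r) UNIV"
    by (rule P.converges_subseq[OF r(1) q(2)])
  have "convergent (\<lambda>k. \<phi> ((q \<circ> r) k) (sc_indicator F))" if "closed F" for F
  proof -
    have "infsum (p n) F - infsum (m n) F = infsum (c n) F" for n
    proof -
      have "p n = (\<lambda>x. c n x + m n x)"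
        by (auto simp: p_def m_def)
      moreover have "c n summable_on F"
        using c(1)[of n] by (rule summable_on_subset_banach) simp
      ultimately show ?thesis
        by (simp add: infsum_add summable)
    qed
    moreover have "convergent (\<lambda>k. infsum (p ((q \<circ> r) k)) F)" "convergent (\<lambda>k. infsum (m ((q \<circ> r) k)) F)"
      using \<open>P.converges (id \<circ> q \<circ> r) UNIV\<close> r(2) that
      unfolding P.converges_def M.converges_def by auto
    ultimately show ?thesis
      using convergent_diff c(3)[OF that] by fastforce
  qed
  then show thesis
    using that strict_mono_o[OF q(1) r(1)] by blast
qed

text \<open>The uniform bound \<open>R\<close> transfers convergence from the dense step functions
  to all of SC(X) by a three-term estimate, and also bounds the limit functional.\<close>

lemma functionals_convergent:
  fixes \<phi> :: "nat \<Rightarrow> 'a::topological_space sc \<Rightarrow>\<^sub>L real"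
  assumes R: "\<And>n. norm (\<phi> n) \<le> R"
    and conv: "\<And>F. closed F \<Longrightarrow> convergent (\<lambda>n. \<phi> n (sc_indicator F))"
  obtains \<psi> :: "'a sc \<Rightarrow>\<^sub>L real" where "\<And>f. (\<lambda>n. \<phi> n f) \<longlonglongrightarrow> \<psi> f"
proof -
  have bound: "\<bar>\<phi> n f\<bar> \<le> R * norm f" for n f
    using norm_blinfun[of "\<phi> n" f] mult_right_mono[OF R[of n] norm_ge_zero[of f]] by simp
  have "0 \<le> R"
    using R norm_ge_zero order_trans by blast
  have step: "convergent (\<lambda>n. \<phi> n g)" if "g \<in> sc_step UNIV" for g
    using that
  proof (induction rule: span_induct_alt)
    case base
    then show ?case by (simp add: blinfun.zero_right convergent_const)
  next
    case (step c u v)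
    then have "convergent (\<lambda>n. \<phi> n u)"
      using conv by auto
    then have "convergent (\<lambda>n. c * \<phi> n u + \<phi> n v)"
      using step by (intro convergent_add convergent_mult convergent_const)
    then show ?case
      by (simp add: blinfun.add_right blinfun.scaleR_right)
  qed
  have "convergent (\<lambda>n. \<phi> n f)" for f
  proof -
    have "Cauchy (\<lambda>n. \<phi> n f)"
    proof (rule metric_CauchyI)
      fix e :: real assume "e > 0"
      then have "e / (4 * (R + 1)) > 0"
        using \<open>0 \<le> R\<close> by simp
      then obtain g where g: "g \<in> sc_step UNIV" "norm (f - g) \<le> e / (4 * (R + 1))"
        by (rule sc_step_dense)
      have "R * norm (f - g) \<le> (R + 1) * (e / (4 * (R + 1)))"
        using g(2) \<open>0 \<le> R\<close> by (intro mult_mono) auto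
      also have "\<dots> = e / 4"
        using \<open>0 \<le> R\<close> nonzero_mult_divide_mult_cancel_left[of "R + 1" e 4]
        by (simp only: times_divide_eq_right mult.commute[of 4])
      finally have "\<bar>\<phi> n f - \<phi> n g\<bar> \<le> e / 4" for n
        using bound[of n "f - g"] by (simp add: blinfun.diff_right)
      note close = this
      have "e / 2 > 0"
        using \<open>e > 0\<close> by simp
      then obtain K where K: "\<forall>m\<ge>K. \<forall>n\<ge>K. dist (\<phi> m g) (\<phi> n g) < e / 2"
        using metric_CauchyD[OF convergent_Cauchy[OF step[OF g(1)]]] by blast
      show "\<exists>K. \<forall>m\<ge>K. \<forall>n\<ge>K. dist (\<phi> m f) (\<phi> n f) < e"
      proof (intro exI[of _ K] allI impI)
        fix m n assume "K \<le> m" "K \<le> n"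
        then have "\<bar>\<phi> m g - \<phi> n g\<bar> < e / 2"
          using K by (simp add: dist_real_def)
        then show "dist (\<phi> m f) (\<phi> n f) < e"
          using close[of m] close[of n] unfolding dist_real_def by linarith
      qed
    qed
    then show ?thesis
      by (rule Cauchy_convergent)
  qed
  then have lim: "(\<lambda>n. \<phi> n f) \<longlonglongrightarrow> lim (\<lambda>n. \<phi> n f)" for f
    by (simp add: convergent_LIMSEQ_iff)
  have "bounded_linear (\<lambda>f. lim (\<lambda>n. \<phi> n f))"
  proof (rule bounded_linear_intro)
    fix f g and c :: real
    have "(\<lambda>n. \<phi> n (f + g)) \<longlonglongrightarrow> lim (\<lambda>n. \<phi> n f) + lim (\<lambda>n. \<phi> n g)"
      unfolding blinfun.add_right by (intro tendsto_add lim)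
    then show "lim (\<lambda>n. \<phi> n (f + g)) = lim (\<lambda>n. \<phi> n f) + lim (\<lambda>n. \<phi> n g)"
      by (rule limI)
    have "(\<lambda>n. \<phi> n (c *\<^sub>R f)) \<longlonglongrightarrow> c *\<^sub>R lim (\<lambda>n. \<phi> n f)"
      unfolding blinfun.scaleR_right by (intro tendsto_scaleR tendsto_const lim)
    then show "lim (\<lambda>n. \<phi> n (c *\<^sub>R f)) = c *\<^sub>R lim (\<lambda>n. \<phi> n f)"
      by (rule limI)
    have "\<bar>lim (\<lambda>n. \<phi> n f)\<bar> \<le> R * norm f"
      by (rule LIMSEQ_le_const2[OF tendsto_rabs[OF lim]]) (use bound in auto)
    then show "norm (lim (\<lambda>n. \<phi> n f)) \<le> norm f * R"
      by (simp add: mult.commute)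
  qed
  then have "blinfun_apply (Blinfun (\<lambda>f. lim (\<lambda>n. \<phi> n f))) f = lim (\<lambda>n. \<phi> n f)" for f
    by (simp add: bounded_linear_Blinfun_apply)
  then show thesis
    using that[of "Blinfun (\<lambda>f. lim (\<lambda>n. \<phi> n f))"] lim by simp
qed

section \<open>Compactness in the weak topology\<close>

text \<open>Open sets of the pullback are preimages, so a cover of \<open>S\<close> comes from a
  cover of its image, and a finite subcover pulls back.\<close>

lemma compactin_pullback_topology:
  assumes "compactin T (f ` S)"
  shows "compactin (pullback_topology UNIV f T) S"
  unfolding compactin_def
proof (intro conjI allI impI)
  show "S \<subseteq> topspace (pullback_topology UNIV f T)"
    using compactin_subset_topspace[OF assms] by (auto simp: topspace_pullback_topology)
  fix \<U> assume \<U>: "Ball \<U> (openin (pullback_topology UNIV f T)) \<and> S \<subseteq> \<Union>\<U>"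
  define \<V> where "\<V> = {V. openin T V \<and> f -` V \<in> \<U>}"
  have "f ` S \<subseteq> \<Union>\<V>"
  proof
    fix y assume "y \<in> f ` S"
    then obtain x U where x: "y = f x" "x \<in> U" "U \<in> \<U>"
      using \<U> by auto
    then obtain V where "openin T V" "U = f -` V"
      using \<U> by (auto simp: openin_pullback_topology)
    then show "y \<in> \<Union>\<V>"
      using x by (auto simp: \<V>_def)
  qed
  moreover have "Ball \<V> (openin T)"
    by (simp add: \<V>_def)
  ultimately obtain \<F> where \<F>: "finite \<F>" "\<F> \<subseteq> \<V>" "f ` S \<subseteq> \<Union>\<F>"
    using assms unfolding compactin_def by meson
  show "\<exists>\<F>. finite \<F> \<and> \<F> \<subseteq> \<U> \<and> S \<subseteq> \<Union>\<F>"
    by (intro exI[of _ "(\<lambda>V. f -` V) ` \<F>"]) (use \<F> in \<open>auto simp: \<V>_def image_subset_iff\<close>)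
qed

(* Banach-Alaoglu, phrased in the function space. *)
lemma compact_bounded_functionals:
  "compact (range blinfun_apply \<inter> {u :: 'b::real_normed_vector \<Rightarrow> real. \<forall>f. \<bar>u f\<bar> \<le> R * norm f})"
proof -
  define L where "L = {u :: 'b \<Rightarrow> real. (\<forall>f g. u (f + g) = u f + u g) \<and> (\<forall>c f. u (c *\<^sub>R f) = c * u f)}"
  \<comment> \<open>A product of compact intervals, compact by Tychonoff; membership in it encodes
    the norm bound.\<close>
  define K where "K = (PiE UNIV (\<lambda>f. {- (R * norm f)..R * norm f}) :: ('b \<Rightarrow> real) set)"
  have "closed L"
    unfolding L_def
    by (intro closed_Collect_conj closed_Collect_all closed_Collect_eq continuous_intros
        continuous_on_product_coordinates)
  moreover have "compact K"
    unfolding K_def compactin_euclidean_iff[symmetric] euclidean_product_topology[symmetric]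
      compactin_PiE
    by simp
  moreover have "range blinfun_apply \<inter> {u. \<forall>f. \<bar>u f\<bar> \<le> R * norm f} = K \<inter> L"
  proof (intro equalityI subsetI)
    fix u assume "u \<in> range blinfun_apply \<inter> {u :: 'b \<Rightarrow> real. \<forall>f. \<bar>u f\<bar> \<le> R * norm f}"
    then show "u \<in> K \<inter> L"
      by (auto simp: K_def L_def PiE_UNIV_domain abs_le_iff blinfun.add_right blinfun.scaleR_right
          minus_le_iff)
  next
    fix u assume "u \<in> K \<inter> L"
    then have u: "\<And>f. \<bar>u f\<bar> \<le> R * norm f" "\<And>f g. u (f + g) = u f + u g" "\<And>c f. u (c *\<^sub>R f) = c * u f"
      by (auto simp: K_def L_def PiE_UNIV_domain abs_le_iff minus_le_iff)
    have "bounded_linear u"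
      by (rule bounded_linear_intro[of _ R]) (use u in \<open>auto simp: mult.commute\<close>)
    then have "u = blinfun_apply (Blinfun u)"
      by (simp add: bounded_linear_Blinfun_apply)
    then show "u \<in> range blinfun_apply \<inter> {u. \<forall>f. \<bar>u f\<bar> \<le> R * norm f}"
      using u(1) by blast
  qed
  ultimately show ?thesis
    by (simp add: compact_Int_closed)
qed

lemma openin_weak_topology:
  "openin weak_topology U \<longleftrightarrow> (\<exists>V. open V \<and> U = (\<lambda>\<mu>. blinfun_apply (integration_map \<mu>)) -` V)"
  unfolding weak_topology_def weak_star_topology_def openin_pullback_topology
  by (auto simp: vimage_def)

lemma topspace_weak_topology [simp]: "topspace weak_topology = UNIV"
  by (simp add: weak_topology_def weak_star_topology_def topspace_pullback_topology)

theorem theoremC: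
  fixes S :: "'a::topological_space signed_measure set"
  assumes "zariski_space (euclidean :: 'a topology)"
    and "closedin weak_topology S"
    and "strongly_bounded S"
  shows "compactin weak_topology S \<and> seq_compactin weak_topology S"
proof
  note X = assms(1)
  define ev where "ev = (\<lambda>\<mu> :: 'a signed_measure. blinfun_apply (integration_map \<mu>))"
  obtain R where R: "\<And>\<mu>. \<mu> \<in> S \<Longrightarrow> norm (integration_map \<mu>) \<le> R"
    using assms(3) unfolding strongly_bounded_def bounded_iff by auto
  have bound: "\<bar>ev \<mu> f\<bar> \<le> R * norm f" if "\<mu> \<in> S" for \<mu> f
    using norm_blinfun[of "integration_map \<mu>" f] mult_right_mono[OF R[OF that] norm_ge_zero[of f]]
    by (simp add: ev_def)
  \<comment> \<open>The weak topology is induced by \<open>ev\<close>, so the weakly closed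
    \<open>S\<close> is the preimage of a closed set \<open>C\<close> of functions; both halves rest
    on \<open>C\<close>.\<close>
  have "openin weak_topology (- S)"
    using assms(2) by (simp add: closedin_def Compl_eq_Diff_UNIV)
  then obtain V where V: "open V" "- S = ev -` V"
    unfolding openin_weak_topology ev_def by blast
  define C where "C = - V"
  have C: "closed C" "S = ev -` C"
    using V by (auto simp: C_def)
  \<comment> \<open>Surjectivity identifies the values of \<open>ev\<close> with all bounded
    functionals, which makes the image of \<open>S\<close> a closed part of the compact
    ball.\<close>
  have range_ev: "range ev = range blinfun_apply"
    using surj_integration_map[OF X] unfolding ev_def by (metis image_image)
  show "compactin weak_topology S"
  proof -
    have "ev ` S = C \<inter> (range blinfun_apply \<inter> {u. \<forall>f. \<bar>u f\<bar> \<le> R * norm f})"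
      using bound C(2) unfolding range_ev[symmetric] by auto
    then have "compact (ev ` S)"
      using compact_Int_closed[OF compact_bounded_functionals C(1)] by (simp only: Int_commute)
    then have "compactin euclidean (blinfun_apply ` integration_map ` S)"
      by (simp add: ev_def image_image)
    then show ?thesis
      unfolding weak_topology_def weak_star_topology_def by (intro compactin_pullback_topology)
  qed
  show "seq_compactin weak_topology S"
    unfolding seq_compactin_def
  proof (intro conjI allI impI)
    fix s :: "nat \<Rightarrow> 'a signed_measure" assume s: "range s \<subseteq> S"
    then have s_bound: "norm (integration_map (s n)) \<le> R" for n
      using R by auto
    obtain r where r: "strict_mono r"
        "\<And>F. closed F \<Longrightarrow> convergent (\<lambda>k. integration_map (s (r k)) (sc_indicator F))"
      using functionals_subseq_convergent_on_indicators[OF X, of "\<lambda>n. integration_map (s n)" R] s_bound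
      by blast
    obtain \<psi> :: "'a sc \<Rightarrow>\<^sub>L real" where \<psi>: "\<And>f. (\<lambda>n. integration_map (s (r n)) f) \<longlonglongrightarrow> \<psi> f"
      using functionals_convergent[of "\<lambda>n. integration_map (s (r n))" R] s_bound r(2) by blast
    obtain \<mu> where \<mu>: "integration_map \<mu> = \<psi>"
      using surj_integration_map[OF X] by (metis surjD)
    have lim: "(\<lambda>n. ev (s (r n))) \<longlonglongrightarrow> ev \<mu>"
      unfolding limitin_canonical_iff[symmetric] euclidean_product_topology[symmetric]
        limitin_componentwise
      using \<psi> \<mu> by (simp add: ev_def)
    have "ev (s (r n)) \<in> C" for n
      using s unfolding C(2) by auto
    then have "ev \<mu> \<in> C"
      by (intro Lim_in_closed_set[OF C(1) _ _ lim]) auto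
    then have "\<mu> \<in> S"
      using C(2) by simp
    moreover have "limitin weak_topology (s \<circ> r) \<mu> sequentially"
      unfolding limitin_def openin_weak_topology ev_def[symmetric]
    proof (intro conjI allI impI)
      fix U assume "(\<exists>V. open V \<and> U = ev -` V) \<and> \<mu> \<in> U"
      then obtain V where "open V" "U = ev -` V" "ev \<mu> \<in> V"
        by auto
      then show "\<forall>\<^sub>F n in sequentially. (s \<circ> r) n \<in> U"
        using topological_tendstoD[OF lim, of V] by simp
    qed simp
    ultimately show "\<exists>l\<in>S. \<exists>r. strict_mono r \<and> limitin weak_topology (s \<circ> r) l sequentially"
      using r(1) by blast
  qed simp
qed

end
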